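(* Let $r\ge0$ be an integer, and let $F_r$, the sequences $\{\gamma(k)\}$, $\{\delta(k)\}$, the cost function $c$, the class of information with constant truncation parameters, and $\mathrm{comp}(\varepsilon)$ be as in the context. For any constants $\hat K$ and $\hat K_1$, if the class of information satisfies condition (C) of the context, then there exist positive numbers $C_2$ and $\varepsilon_0$ such that for all $\varepsilon\in(0,\varepsilon_0)$ $$\mathrm{comp}(\varepsilon)\ge C_2\; n(\varepsilon)\; c\bigl(N(\varepsilon/C_2)\bigr)\; N(\varepsilon/C_2),$$ where $$n(\varepsilon)=(1/\varepsilon)^{1/\max\{r,1\}},\qquad N(\varepsilon)=\max\bigl\{\gamma^{-1}(\varepsilon),\,\delta^{-1}(\varepsilon)\bigr\},$$ and for a nonincreasing sequence $g$ convergent to $0$, $g^{-1}(\varepsilon):=\min\{k\in\mathbb N:g(k)\le\varepsilon\}$.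
   Context: **Space.** $(E,\|\cdot\|)$ is an infinite-dimensional real Banach space with a Schauder basis $\{e_1,e_2,\dots\}$, $\|e_j\|=1$. For $y=\sum_j y^je_j$ put $P_ky=\sum_{j=1}^k y^je_j$, and let $P=\sup_k\|P_k\|<\infty$. For $f:E\to E$ write $f(y)=\sum_j f^j(y)e_j$. Let $a<b$. For Lipschitz $f$ and $\eta\in E$, $z:[a,b]\to E$ denotes the unique solution of $z'(t)=f(z(t))$, $z(a)=\eta$. **Class $F_r$.** Let $L,M,D>0$ and let $\Gamma=\{\gamma(k)\}_{k\ge1}$, $\Delta=\{\delta(k)\}_{k\ge1}$ be positive, nonincreasing sequences convergent to zero. Consider pairs $(f,\eta)$ with (A1) $\|\eta-P_k\eta\|\le\gamma(k)$ for $k\in\mathbb N$; (A2) $\|f(y)-f(\bar y)\|\le L\|y-\bar y\|$ for $y,\bar y\in E$; (A3) $\|f(\eta)\|\le M$. Let $R$ be a fixed number, depending only on $L,M,\gamma(1),P,a,b$, such that for all pairs satisfying (A1)–(A3) the solution $z$ stays in $K=K(\eta,R)=\{y\in E:\|y-\eta\|\le R\}$ on $[a,b]$, and, for all sufficiently fine partitions, so do the local solutions $\bar z_k$ of the following algorithm. Algorithm $\phi^*_{n,\vec N}$ (partition $a=t_0<\dots<t_n=b$, $h_k=t_{k+1}-t_k$, $\vec N=[N_{-1},\dots,N_{n-1}]$): $\bar f_k=P_{N_k}f$, $\bar y_0=P_{N_{-1}}\eta$; given $\bar y_k$, set $\bar l_{k,0}\equiv\bar y_k$ and, for $s=0,\dots,\max\{r,1\}-1$,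 $\bar l_{k,s+1}(t)=\bar y_k+\int_{t_k}^t\bar q_{k,s}(\xi)d\xi$, where $\bar q_{k,s}$ is the Lagrange polynomial of degree at most $s$ interpolating $\bar f_k(\bar l_{k,s}(\cdot))$ at $t_k+ph_k/s$, $p=0,\dots,s$ (at $t_k$ if $s=0$); $\bar y_{k+1}=\bar l_{k,\max\{r,1\}}(t_{k+1})$; and $\bar z_k'=\bar f_k(\bar z_k)$ on $[t_k,t_{k+1}]$, $\bar z_k(t_k)=\bar y_k$. ("Sufficiently fine": for each nonincreasing $\alpha(n)\to0$ there is $\hat n$ such that the property holds for all $n\ge\hat n$, all partitions with $\max_kh_k\le\alpha(n)$, all $\vec N$ and all $(f,\eta)$ satisfying (A1)–(A3). Such an $R$ exists.) The class $F_r$ consists of all pairs satisfying (A1)–(A3) and (A4) $f\in C^r(K)$ (Fréchet derivatives) and $\sup_{y\in K}\|f^{(l)}(y)\|\le D$ for $l=1,\dots,r$; (A5) $\sup_{y\in K}\|f(y)-P_kf(y)\|\le\delta(k)$ for $k\in\mathbb N$. **Information and algorithms with constant truncation parameter $N$.** A nonincreasing sequence $\{\alpha(n)\}$ convergent to $0$ with $\alpha(n)\le\hat K_1n^{-1}$ is given, and for each $n$ the partition $a=t_0<\dots<t_n=b$ is fixed in advance and satisfies $\max_k(t_{k+1}-t_k)\le\alpha(n)$. Information $\mathcal N_{n,N}(f,\eta)$ consists of $P_N\eta$ and, for each time step $[t_k,t_{k+1}]$, of finitely many real numbers, each being the value of a component $f^j(P_Ny)$, $1\le j\le N$, or of a partial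 derivative of order at most $r$ (with respect to the first $N$ coordinates) of $f^j$ at $P_Ny$, for some information point $y$. The total number of information points is at most $\hat Kn$. Information points, indices $j$ and orders of derivatives may be chosen adaptively (based on information computed so far). An algorithm $\phi_{n,N}$ is a mapping assigning to $\mathcal N_{n,N}(f,\eta)$ a function $l:[a,b]\to E$ (composed of pieces on $[t_k,t_{k+1}]$). Its error is $e(\phi_{n,N},\mathcal N_{n,N},F_r)=\sup_{(f,\eta)\in F_r}\sup_{t\in[a,b]}\|z(t)-l(t)\|$. **Cost and complexity.** $c$ is a nondecreasing nonnegative function on $\mathbb N$; one scalar evaluation at a point $P_Ny$ costs $c(N)$. The number of scalar evaluations in a time step is denoted $\ell(N,N)$ (it depends on the particular information and on the time step); access to $P_N\eta$ is free. The cost of $\mathcal N_{n,N}$ is the sum over the $n$ time steps of $c(N)\,\ell(N,N)$. $\mathrm{comp}(\varepsilon)$ is the infimum of this cost over all $n$, $N$ and all information $\mathcal N_{n,N}$ in the class under consideration for which there is an algorithm $\phi_{n,N}$ with $e(\phi_{n,N},\mathcal N_{n,N},F_r)\le\varepsilon$. **Condition (C).** For any information in the class (used by an algorithm for solving the problem with right-hand side $P_Nf$ and initial condition $P_N\eta$), in $\Omega(n)$ time intervals it holds $\ell(N,N)=\Omega(N)$, with coefficients in the $\Omega$-notation depending only on $\hat K$, $\hat K_1$, the parameters of the class $F_r$, $a$ and $b$. That is, there are positive constants $\kappa_1,\kappa_2$, depending only on these quantities, such that for every $\mathcal N_{n,N}$ in the class, in at least $\kappa_1n$ of the intervals $[t_k,t_{k+1}]$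 at least $\kappa_2N$ scalar evaluations are performed. *)

theory Defs
  imports "HOL-Analysis.Analysis"
begin

text \<open>
  Coordinates are numbered from \<open>0\<close>: the basis vector usually written \<open>e\<^sub>1\<close> is \<open>e 0\<close>, and the
  first \<open>N\<close> coordinates are those with index \<open>j < N\<close>. The truncation \<open>proj e k\<close> therefore keeps
  \<open>k\<close> coordinates, exactly as \<open>P\<^sub>k\<close> does.
\<close>

definition schauder_basis :: "(nat \<Rightarrow> 'a::real_normed_vector) \<Rightarrow> bool" where
  "schauder_basis e \<longleftrightarrow> (\<forall>y. \<exists>!x :: nat \<Rightarrow> real. (\<lambda>j. x j *\<^sub>R e j) sums y)"

definition coord :: "(nat \<Rightarrow> 'a::real_normed_vector) \<Rightarrow> 'a \<Rightarrow> nat \<Rightarrow> real" where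
  "coord e y = (THE x. (\<lambda>j. x j *\<^sub>R e j) sums y)"

definition proj :: "(nat \<Rightarrow> 'a::real_normed_vector) \<Rightarrow> nat \<Rightarrow> 'a \<Rightarrow> 'a" where
  "proj e k y = (\<Sum>j<k. coord e y j *\<^sub>R e j)"

definition basis_constant :: "(nat \<Rightarrow> 'a::real_normed_vector) \<Rightarrow> ereal" where
  "basis_constant e = (SUP k\<in>{1..}. SUP y\<in>cball 0 1. ereal (norm (proj e k y)))"

text \<open>The value of such a sequence at index \<open>0\<close> is irrelevant.\<close>

definition nonincreasing_null :: "(nat \<Rightarrow> real) \<Rightarrow> bool" where
  "nonincreasing_null g \<longleftrightarrow> (\<forall>k\<ge>1. g (Suc k) \<le> g k) \<and> g \<longlonglongrightarrow> 0"

definition positive_nonincreasing_null :: "(nat \<Rightarrow> real) \<Rightarrow> bool" where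
  "positive_nonincreasing_null g \<longleftrightarrow> nonincreasing_null g \<and> (\<forall>k\<ge>1. 0 < g k)"

definition seq_inverse :: "(nat \<Rightarrow> real) \<Rightarrow> real \<Rightarrow> nat" where
  "seq_inverse g \<epsilon> = (LEAST k. 1 \<le> k \<and> g k \<le> \<epsilon>)"

text \<open>
  The \<open>l\<close>-th derivative at a point is an \<open>l\<close>-linear map, represented as a function on lists of
  directions; only its values on lists of length \<open>l\<close> matter. \<open>mult_norm_le l A B\<close> says that the
  usual norm of the \<open>l\<close>-linear map \<open>A\<close> is at most \<open>B\<close>.
\<close>

definition multilinear :: "nat \<Rightarrow> ('a::real_vector list \<Rightarrow> 'a) \<Rightarrow> bool" where
  "multilinear l A \<longleftrightarrow>
     (\<forall>hs i. length hs = l \<and> i < l \<longrightarrow> linear (\<lambda>h. A (hs[i := h])))"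

definition mult_norm_le :: "nat \<Rightarrow> ('a::real_normed_vector list \<Rightarrow> 'a) \<Rightarrow> real \<Rightarrow> bool" where
  "mult_norm_le l A B \<longleftrightarrow>
     (\<forall>hs. length hs = l \<longrightarrow> norm (A hs) \<le> B * prod_list (map norm hs))"

text \<open>
  \<open>DF 0, \<dots>, DF r\<close> are the derivatives of \<open>f\<close> on \<open>S\<close> (relative to \<open>S\<close>), and the last one is
  continuous on \<open>S\<close>. Each \<open>DF (Suc l)\<close> is the derivative of \<open>DF l\<close> for the norm of \<open>l\<close>-linear maps.
\<close>

definition derivatives_on ::
  "'a::real_normed_vector set \<Rightarrow> ('a \<Rightarrow> 'a) \<Rightarrow> nat \<Rightarrow> (nat \<Rightarrow> 'a \<Rightarrow> 'a list \<Rightarrow> 'a) \<Rightarrow> bool" where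
  "derivatives_on S f r DF \<longleftrightarrow>
     (\<forall>y\<in>S. DF 0 y [] = f y) \<and>
     (\<forall>l\<le>r. \<forall>y\<in>S. multilinear l (DF l y) \<and> (\<exists>B. mult_norm_le l (DF l y) B)) \<and>
     (\<forall>l<r. \<forall>y\<in>S. \<forall>\<epsilon>>0. \<exists>\<delta>>0. \<forall>x\<in>S. norm (x - y) < \<delta> \<longrightarrow>
        mult_norm_le l (\<lambda>hs. DF l x hs - DF l y hs - DF (Suc l) y ((x - y) # hs))
          (\<epsilon> * norm (x - y))) \<and>
     (\<forall>y\<in>S. \<forall>\<epsilon>>0. \<exists>\<delta>>0. \<forall>x\<in>S. norm (x - y) < \<delta> \<longrightarrow>
        mult_norm_le r (\<lambda>hs. DF r x hs - DF r y hs) \<epsilon>)"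

definition solves_ivp ::
  "('a::real_normed_vector \<Rightarrow> 'a) \<Rightarrow> real \<Rightarrow> real \<Rightarrow> 'a \<Rightarrow> (real \<Rightarrow> 'a) \<Rightarrow> bool" where
  "solves_ivp f a b \<eta> z \<longleftrightarrow>
     z a = \<eta> \<and> (\<forall>t\<in>{a..b}. (z has_vector_derivative f (z t)) (at t within {a..b}))"

definition basic_class ::
  "(nat \<Rightarrow> 'a::real_normed_vector) \<Rightarrow> real \<Rightarrow> real \<Rightarrow> (nat \<Rightarrow> real) \<Rightarrow> (('a \<Rightarrow> 'a) \<times> 'a) set" where
  "basic_class e L M \<gamma> = {(f, \<eta>).
     (\<forall>k\<ge>1. norm (\<eta> - proj e k \<eta>) \<le> \<gamma> k) \<and>
     L-lipschitz_on UNIV f \<and>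
     norm (f \<eta>) \<le> M}"

definition class_F ::
  "(nat \<Rightarrow> 'a::real_normed_vector) \<Rightarrow> nat \<Rightarrow> real \<Rightarrow> real \<Rightarrow> real \<Rightarrow> (nat \<Rightarrow> real) \<Rightarrow> (nat \<Rightarrow> real)
     \<Rightarrow> real \<Rightarrow> (('a \<Rightarrow> 'a) \<times> 'a) set" where
  "class_F e r L M D \<gamma> \<delta> R = {(f, \<eta>) \<in> basic_class e L M \<gamma>.
     (\<exists>DF. derivatives_on (cball \<eta> R) f r DF \<and>
           (\<forall>l\<in>{1..r}. \<forall>y\<in>cball \<eta> R. mult_norm_le l (DF l y) D)) \<and>
     (\<forall>k\<ge>1. \<forall>y\<in>cball \<eta> R. norm (f y - proj e k (f y)) \<le> \<delta> k)}"

definition is_partition :: "real \<Rightarrow> real \<Rightarrow> nat \<Rightarrow> (nat \<Rightarrow> real) \<Rightarrow> bool" where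
  "is_partition a b n t \<longleftrightarrow> t 0 = a \<and> t n = b \<and> (\<forall>k<n. t k < t (Suc k))"

definition mesh_le :: "nat \<Rightarrow> (nat \<Rightarrow> real) \<Rightarrow> real \<Rightarrow> bool" where
  "mesh_le n t h \<longleftrightarrow> (\<forall>k<n. t (Suc k) - t k \<le> h)"

definition lagrange_interpolant ::
  "nat \<Rightarrow> (nat \<Rightarrow> real) \<Rightarrow> (real \<Rightarrow> 'a::real_vector) \<Rightarrow> real \<Rightarrow> 'a" where
  "lagrange_interpolant s x g t =
     (\<Sum>p\<le>s. (\<Prod>q\<in>{..s} - {p}. (t - x q) / (x p - x q)) *\<^sub>R g (x p))"

text \<open>For \<open>s = 0\<close> the only node is \<open>t0\<close>, because \<open>x / 0 = 0\<close>.\<close>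

primrec local_iterate ::
  "('a::banach \<Rightarrow> 'a) \<Rightarrow> 'a \<Rightarrow> real \<Rightarrow> real \<Rightarrow> nat \<Rightarrow> real \<Rightarrow> 'a" where
  "local_iterate g y t0 h 0 = (\<lambda>t. y)"
| "local_iterate g y t0 h (Suc s) = (\<lambda>t. y + integral {t0..t}
     (lagrange_interpolant s (\<lambda>p. t0 + real p * h / real s)
        (\<lambda>\<xi>. g (local_iterate g y t0 h s \<xi>))))"

text \<open>
  The truncation parameters \<open>N\<^sub>-\<^sub>1, N\<^sub>0, \<dots>, N\<^sub>n\<^sub>-\<^sub>1\<close> are stored as \<open>Nv 0, Nv 1, \<dots>, Nv n\<close>.
\<close>

definition truncated_rhs ::
  "(nat \<Rightarrow> 'a::real_normed_vector) \<Rightarrow> ('a \<Rightarrow> 'a) \<Rightarrow> (nat \<Rightarrow> nat) \<Rightarrow> nat \<Rightarrow> 'a \<Rightarrow> 'a" where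
  "truncated_rhs e f Nv k y = proj e (Nv (Suc k)) (f y)"

primrec algorithm_value ::
  "(nat \<Rightarrow> 'a::banach) \<Rightarrow> nat \<Rightarrow> ('a \<Rightarrow> 'a) \<Rightarrow> 'a \<Rightarrow> (nat \<Rightarrow> real) \<Rightarrow> (nat \<Rightarrow> nat) \<Rightarrow> nat \<Rightarrow> 'a" where
  "algorithm_value e r f \<eta> t Nv 0 = proj e (Nv 0) \<eta>"
| "algorithm_value e r f \<eta> t Nv (Suc k) =
     local_iterate (truncated_rhs e f Nv k) (algorithm_value e r f \<eta> t Nv k)
       (t k) (t (Suc k) - t k) (max r 1) (t (Suc k))"

text \<open>
  The radius \<open>R\<close> is such that the exact solutions, and the exact solutions of the local truncated
  problems started from the algorithm's values on sufficiently fine partitions, stay in the ball.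
\<close>

definition admissible_radius ::
  "(nat \<Rightarrow> 'a::banach) \<Rightarrow> nat \<Rightarrow> real \<Rightarrow> real \<Rightarrow> (nat \<Rightarrow> real) \<Rightarrow> real \<Rightarrow> real \<Rightarrow> real \<Rightarrow> bool" where
  "admissible_radius e r L M \<gamma> a b R \<longleftrightarrow>
     (\<forall>(f, \<eta>)\<in>basic_class e L M \<gamma>. \<forall>z. solves_ivp f a b \<eta> z \<longrightarrow> z ` {a..b} \<subseteq> cball \<eta> R) \<and>
     (\<forall>\<alpha>. nonincreasing_null \<alpha> \<longrightarrow> (\<exists>n0. \<forall>n\<ge>n0. \<forall>t Nv.
        1 \<le> n \<and> is_partition a b n t \<and> mesh_le n t (\<alpha> n) \<and> (\<forall>k\<le>n. 1 \<le> Nv k) \<longrightarrow>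
        (\<forall>(f, \<eta>)\<in>basic_class e L M \<gamma>. \<forall>k<n. \<forall>z.
           solves_ivp (truncated_rhs e f Nv k) (t k) (t (Suc k)) (algorithm_value e r f \<eta> t Nv k) z
             \<longrightarrow> z ` {t k..t (Suc k)} \<subseteq> cball \<eta> R)))"

primrec partial_derivative ::
  "(nat \<Rightarrow> 'a::real_normed_vector) \<Rightarrow> nat list \<Rightarrow> ('a \<Rightarrow> real) \<Rightarrow> 'a \<Rightarrow> real" where
  "partial_derivative e [] g x = g x"
| "partial_derivative e (i # is) g x = deriv (\<lambda>s. partial_derivative e is g (x + s *\<^sub>R e i)) 0"

text \<open>
  \<open>Information n N ev qu\<close>: there are \<open>n\<close> time steps, the truncation parameter is \<open>N\<close>, and \<open>ev k\<close>
  scalar evaluations are made in step \<open>k\<close>. The next evaluation, \<open>qu v vals = (y, j, is)\<close>, depends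
  on \<open>v\<close>, the truncated initial value, and on the list \<open>vals\<close> of all values computed so far; it
  asks for the partial derivative of the \<open>j\<close>-th component with respect to the coordinates listed
  in \<open>is\<close> (the value itself if \<open>is = []\<close>) at the truncation of the information point \<open>y\<close>.
\<close>

datatype 'a information =
  Information (steps: nat) (trunc: nat) (evals: "nat \<Rightarrow> nat")
    (query: "'a \<Rightarrow> real list \<Rightarrow> 'a \<times> nat \<times> nat list")

definition answer ::
  "(nat \<Rightarrow> 'a::real_normed_vector) \<Rightarrow> nat \<Rightarrow> ('a \<Rightarrow> 'a) \<Rightarrow> 'a \<times> nat \<times> nat list \<Rightarrow> real" where
  "answer e N f = (\<lambda>(y, j, is). partial_derivative e is (\<lambda>x. coord e (f x) j) (proj e N y))"

primrec computed_values ::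
  "(nat \<Rightarrow> 'a::real_normed_vector) \<Rightarrow> 'a information \<Rightarrow> ('a \<Rightarrow> 'a) \<Rightarrow> 'a \<Rightarrow> nat \<Rightarrow> real list" where
  "computed_values e I f \<eta> 0 = []"
| "computed_values e I f \<eta> (Suc m) = computed_values e I f \<eta> m @
     [answer e (trunc I) f (query I (proj e (trunc I) \<eta>) (computed_values e I f \<eta> m))]"

definition asked ::
  "(nat \<Rightarrow> 'a::real_normed_vector) \<Rightarrow> 'a information \<Rightarrow> ('a \<Rightarrow> 'a) \<Rightarrow> 'a \<Rightarrow> nat \<Rightarrow> 'a \<times> nat \<times> nat list"
  where
  "asked e I f \<eta> m = query I (proj e (trunc I) \<eta>) (computed_values e I f \<eta> m)"

definition total_evals :: "'a information \<Rightarrow> nat" where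
  "total_evals I = (\<Sum>k<steps I. evals I k)"

definition information_value ::
  "(nat \<Rightarrow> 'a::real_normed_vector) \<Rightarrow> 'a information \<Rightarrow> ('a \<Rightarrow> 'a) \<Rightarrow> 'a \<Rightarrow> 'a \<times> real list" where
  "information_value e I f \<eta> =
     (proj e (trunc I) \<eta>, computed_values e I f \<eta> (total_evals I))"

definition valid_information ::
  "(nat \<Rightarrow> 'a::real_normed_vector) \<Rightarrow> nat \<Rightarrow> real \<Rightarrow> (('a \<Rightarrow> 'a) \<times> 'a) set \<Rightarrow> 'a information set" where
  "valid_information e r Khat F = {I. 1 \<le> steps I \<and> 1 \<le> trunc I \<and>
     (\<forall>(f, \<eta>)\<in>F.
        (\<forall>m<total_evals I. case asked e I f \<eta> m of (y, j, is) \<Rightarrow>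
           j < trunc I \<and> length is \<le> r \<and> set is \<subseteq> {..<trunc I}) \<and>
        real (card ((\<lambda>m. fst (asked e I f \<eta> m)) ` {..<total_evals I})) \<le> Khat * real (steps I))}"

definition algorithm_error ::
  "(nat \<Rightarrow> 'a::real_normed_vector) \<Rightarrow> real \<Rightarrow> real \<Rightarrow> (('a \<Rightarrow> 'a) \<times> 'a) set
     \<Rightarrow> ('a \<times> real list \<Rightarrow> real \<Rightarrow> 'a) \<Rightarrow> 'a information \<Rightarrow> ereal" where
  "algorithm_error e a b F \<phi> I =
     (SUP (f, \<eta>, z)\<in>{(f, \<eta>, z). (f, \<eta>) \<in> F \<and> solves_ivp f a b \<eta> z}.
        SUP t\<in>{a..b}. ereal (norm (z t - \<phi> (information_value e I f \<eta>) t)))"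

definition info_cost :: "(nat \<Rightarrow> real) \<Rightarrow> 'a information \<Rightarrow> real" where
  "info_cost c I = (\<Sum>k<steps I. c (trunc I) * real (evals I k))"

text \<open>The infimum over the empty set is \<open>\<infinity>\<close>.\<close>

definition complexity ::
  "(nat \<Rightarrow> 'a::real_normed_vector) \<Rightarrow> real \<Rightarrow> real \<Rightarrow> (('a \<Rightarrow> 'a) \<times> 'a) set \<Rightarrow> (nat \<Rightarrow> real)
     \<Rightarrow> 'a information set \<Rightarrow> real \<Rightarrow> ereal" where
  "complexity e a b F c \<I> \<epsilon> =
     (INF I\<in>{I \<in> \<I>. \<exists>\<phi>. algorithm_error e a b F \<phi> I \<le> ereal \<epsilon>}. ereal (info_cost c I))"

definition condition_C :: "'a information set \<Rightarrow> bool" where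
  "condition_C \<I> \<longleftrightarrow> (\<exists>\<kappa>1>0. \<exists>\<kappa>2>0. \<forall>I\<in>\<I>.
     real (card {k. k < steps I \<and> real (evals I k) \<ge> \<kappa>2 * real (trunc I)}) \<ge> \<kappa>1 * real (steps I))"

definition n_of :: "nat \<Rightarrow> real \<Rightarrow> real" where
  "n_of r \<epsilon> = (1 / \<epsilon>) powr (1 / real (max r 1))"

definition N_of :: "(nat \<Rightarrow> real) \<Rightarrow> (nat \<Rightarrow> real) \<Rightarrow> real \<Rightarrow> nat" where
  "N_of \<gamma> \<delta> \<epsilon> = max (seq_inverse \<gamma> \<epsilon>) (seq_inverse \<delta> \<epsilon>)"

end

theory Submission
  imports Defs "HOL-Computational_Algebra.Polynomial"
begin

text \<open>
  If an algorithm has error at most \<open>\<epsilon>\<close> and two problems of the class produce the same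
  information, then their solutions differ by at most \<open>2 \<epsilon>\<close>, because the algorithm answers both with
  the same function (\<open>indistinguishable_solutions_close\<close>). Three pairs of problems, all with
  explicitly known solutions, turn this into lower bounds for the truncation parameter \<open>N\<close> and
  for the number \<open>n\<close> of time steps.

  \<^item> For the zero right-hand side, the initial values \<open>0\<close> and \<open>\<gamma> N *\<^sub>R e N\<close> have the same
    truncation, so \<open>\<gamma> N \<le> 2 \<epsilon>\<close> (\<open>initial_tail_le_error\<close>).
  \<^item> The constant right-hand sides \<open>0\<close> and \<open>min (\<delta> N) M *\<^sub>R e N\<close> have the same first \<open>N\<close>
    components, so \<open>min (\<delta> N) M * (b - a) \<le> 2 \<epsilon>\<close> (\<open>rhs_tail_le_error\<close>).
  \<^item> To the constant right-hand side \<open>m *\<^sub>R e 0\<close>, whose solution moves along the first axis with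
    speed \<open>m\<close>, add bumps in the direction \<open>e 1\<close> that depend on the first coordinate only. The
    interval of length \<open>m * (b - a)\<close> swept by the solution is cut into a fixed multiple of \<open>n\<close> cells,
    at least four times the number of information points, and a bump is put into each cell that
    contains no first coordinate of an information point. With \<open>s = max r 1\<close>, bumps of width of order
    \<open>1 / n\<close> and height of order \<open>n\<close> to the power \<open>-s\<close> respect the bounds on the derivatives, and
    at least half of the cells carry one. The second components of the two solutions are then
    \<open>0\<close> and an integral over the bumps, and at \<open>b\<close> they differ by a constant times \<open>n\<close> to the
    power \<open>-s\<close> (\<open>error_times_steps_power_bounded_below\<close>).

  The first two bounds give \<open>N \<ge> N_of \<gamma> \<delta> (\<epsilon> / C2)\<close>, the third one makes \<open>n\<close> at least a constant
  times \<open>n_of r \<epsilon>\<close>, and \<open>condition_C\<close> bounds the cost from below by a constant times \<open>n * c N * N\<close>.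

  All right-hand sides involved are ridge functions, that is, of the form
  \<open>y \<mapsto> v + g (coord e y 0) *\<^sub>R w\<close>. The bump direction \<open>e 1\<close> has first coordinate \<open>0\<close>, so that
  the bumps do not influence the first coordinate of the solution; this is why the perturbed
  equation is solved by a mere integration.
\<close>

section \<open>Coordinates and truncations\<close>

lemma coord_sums:
  assumes "schauder_basis e"
  shows "(\<lambda>j. coord e y j *\<^sub>R e j) sums y"
proof -
  have "\<exists>!x. (\<lambda>j. x j *\<^sub>R e j) sums y"
    using assms unfolding schauder_basis_def by blast
  from theI'[OF this] show ?thesis unfolding coord_def .
qed

lemma coord_eqI:
  assumes "schauder_basis e" and "(\<lambda>j. x j *\<^sub>R e j) sums y"
  shows "coord e y = x"
  using assms coord_sums[OF assms(1), of y] unfolding schauder_basis_def by blast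

lemma linear_coord:
  assumes "schauder_basis e"
  shows "linear (\<lambda>y. coord e y j)"
proof (rule linearI)
  fix x y
  have "(\<lambda>j. (coord e x j + coord e y j) *\<^sub>R e j) sums (x + y)"
    using sums_add[OF coord_sums[OF assms] coord_sums[OF assms]] by (simp add: scaleR_left_distrib)
  from coord_eqI[OF assms this] show "coord e (x + y) j = coord e x j + coord e y j" by simp
next
  fix s x
  have "(\<lambda>j. (s * coord e x j) *\<^sub>R e j) sums (s *\<^sub>R x)"
    using bounded_linear.sums[OF bounded_linear_scaleR_right coord_sums[OF assms]] by simp
  from coord_eqI[OF assms this] show "coord e (s *\<^sub>R x) j = s *\<^sub>R coord e x j" by simp
qed

lemma coord_finite_sum:
  assumes "schauder_basis e"
  shows "coord e (\<Sum>j<k. x j *\<^sub>R e j) j = (if j < k then x j else 0)"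
proof -
  have "(\<lambda>j. (if j < k then x j else 0) *\<^sub>R e j) sums (\<Sum>j<k. (if j < k then x j else 0) *\<^sub>R e j)"
    by (rule sums_finite) auto
  then have "(\<lambda>j. (if j < k then x j else 0) *\<^sub>R e j) sums (\<Sum>j<k. x j *\<^sub>R e j)"
    by simp
  from coord_eqI[OF assms this] show ?thesis by simp
qed

lemma coord_basis:
  assumes "schauder_basis e"
  shows "coord e (e i) j = (if j = i then 1 else 0)"
proof -
  have "(\<Sum>j<Suc i. (if j = i then 1 else 0) *\<^sub>R e j) = e i"
    by simp
  then show ?thesis
    using coord_finite_sum[OF assms, of "\<lambda>j. if j = i then 1 else 0" "Suc i" j] by auto
qed

lemma linear_proj:
  assumes "schauder_basis e"
  shows "linear (proj e k)"
  using linear_coord[OF assms]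
  by (intro linearI) (simp_all add: proj_def linear_iff scaleR_left_distrib sum.distrib scaleR_sum_right)

lemma proj_basis:
  assumes "schauder_basis e"
  shows "proj e k (x *\<^sub>R e i) = (if i < k then x *\<^sub>R e i else 0)"
proof -
  have "proj e k (e i) = (\<Sum>j<k. if j = i then e i else 0)"
    unfolding proj_def by (rule sum.cong) (auto simp: coord_basis[OF assms])
  also have "\<dots> = (if i < k then e i else 0)"
    by simp
  finally show ?thesis
    using linear_scale[OF linear_proj[OF assms]] by simp
qed

text \<open>
  The first coordinate is bounded because \<open>proj e 1 y\<close> is \<open>coord e y 0 *\<^sub>R e 0\<close>.
\<close>

lemma bounded_first_coord:
  assumes "schauder_basis e" and "norm (e 0) = 1" and "basis_constant e < \<infinity>"
  obtains P where "1 \<le> P" and "\<And>y. \<bar>coord e y 0\<bar> \<le> P * norm y"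
proof -
  have le: "ereal (norm (proj e 1 y)) \<le> basis_constant e" if "norm y \<le> 1" for y
    unfolding basis_constant_def using that by (intro SUP_upper2[of 1] SUP_upper) auto
  have "0 \<le> basis_constant e"
    using le[of 0] order_trans[of 0 "ereal (norm (proj e 1 0))"] by simp
  then obtain P0 where P0: "basis_constant e = ereal P0"
    using assms(3) by (cases "basis_constant e") auto
  have unit: "\<bar>coord e y 0\<bar> \<le> P0" if "norm y \<le> 1" for y
    using le[OF that] P0 assms(2) by (simp add: proj_def)
  have "\<bar>coord e y 0\<bar> \<le> max 1 P0 * norm y" for y
  proof (cases "y = 0")
    case False
    have "coord e (inverse (norm y) *\<^sub>R y) 0 = inverse (norm y) * coord e y 0"
      using linear_scale[OF linear_coord[OF assms(1)]] by simp
    then have "\<bar>coord e y 0\<bar> / norm y \<le> P0"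
      using unit[of "inverse (norm y) *\<^sub>R y"] False by (simp add: abs_mult divide_inverse mult.commute)
    then have "\<bar>coord e y 0\<bar> \<le> P0 * norm y"
      using False by (simp add: pos_divide_le_eq)
    also have "\<dots> \<le> max 1 P0 * norm y"
      by (intro mult_right_mono) auto
    finally show ?thesis .
  qed (use linear_0[OF linear_coord[OF assms(1)]] in simp)
  then show thesis using that[of "max 1 P0"] by simp
qed

section \<open>Indistinguishable problems\<close>

text \<open>
  Although the queries are adaptive, it suffices that both problems agree on the queries made for
  the first one: as long as the answers agree, so do the next queries.
\<close>

lemma information_value_cong:
  assumes "proj e (trunc I) \<eta>1 = proj e (trunc I) \<eta>2"
    and "\<And>m. m < total_evals I \<Longrightarrow>
      answer e (trunc I) f1 (asked e I f1 \<eta>1 m) = answer e (trunc I) f2 (asked e I f1 \<eta>1 m)"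
  shows "information_value e I f1 \<eta>1 = information_value e I f2 \<eta>2"
proof -
  have "computed_values e I f1 \<eta>1 m = computed_values e I f2 \<eta>2 m" if "m \<le> total_evals I" for m
    using that
  proof (induction m)
    case (Suc m)
    then show ?case using assms(1) assms(2)[of m] by (simp add: asked_def)
  qed simp
  then show ?thesis using assms(1) by (simp add: information_value_def)
qed

lemma indistinguishable_solutions_close:
  assumes "algorithm_error e a b F \<phi> I \<le> ereal \<epsilon>"
    and "(f1, \<eta>1) \<in> F" and "(f2, \<eta>2) \<in> F"
    and "solves_ivp f1 a b \<eta>1 z1" and "solves_ivp f2 a b \<eta>2 z2"
    and same: "information_value e I f1 \<eta>1 = information_value e I f2 \<eta>2"
    and "t \<in> {a..b}"
  shows "norm (z1 t - z2 t) \<le> 2 * \<epsilon>"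
proof -
  have err: "norm (z t - \<phi> (information_value e I f \<eta>) t) \<le> \<epsilon>"
    if "(f, \<eta>) \<in> F" "solves_ivp f a b \<eta> z" for f \<eta> z
  proof -
    have "ereal (norm (z t - \<phi> (information_value e I f \<eta>) t)) \<le> algorithm_error e a b F \<phi> I"
      unfolding algorithm_error_def using that \<open>t \<in> {a..b}\<close>
      by (intro SUP_upper2[of "(f, \<eta>, z)"]) (auto intro!: SUP_upper)
    with assms(1) show ?thesis using order_trans ereal_less_eq(3) by blast
  qed
  from err[OF assms(2,4)] err[OF assms(3,5)] same show ?thesis
    using norm_triangle_ineq4[of "z1 t - \<phi> (information_value e I f1 \<eta>1) t"
        "z2 t - \<phi> (information_value e I f1 \<eta>1) t"] by simp
qed

text \<open>
  Answers that are derivatives depend on the values near the information point. Agreement where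
  \<open>c\<close> takes values in an open set is preserved by partial differentiation, since such a set
  contains a piece of every line through each of its points.
\<close>

lemma partial_derivative_cong_open:
  fixes c :: "'a::real_normed_vector \<Rightarrow> real"
  assumes "linear c" and "open U" and "\<And>x. c x \<in> U \<Longrightarrow> g1 x = g2 x" and "c x \<in> U"
  shows "partial_derivative e is g1 x = partial_derivative e is g2 x"
  using assms(4)
proof (induction "is" arbitrary: x)
  case Nil
  then show ?case using assms(3) by simp
next
  case (Cons i "is")
  have "open ((\<lambda>s. c x + s * c (e i)) -` U)"
    by (intro open_vimage assms(2) continuous_intros)
  then have "eventually (\<lambda>s. s \<in> (\<lambda>s. c x + s * c (e i)) -` U) (nhds 0)"
    by (rule eventually_nhds_in_open) (use Cons.prems in simp)
  then have "eventually (\<lambda>s. partial_derivative e is g1 (x + s *\<^sub>R e i) =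
      partial_derivative e is g2 (x + s *\<^sub>R e i)) (nhds 0)"
    by eventually_elim (simp add: Cons.IH linear_add[OF assms(1)] linear_scale[OF assms(1)])
  then show ?case by (simp add: deriv_cong_ev)
qed

section \<open>Ridge functions\<close>

lemma abs_prod_list_le:
  fixes c :: "'a::real_normed_vector \<Rightarrow> real"
  assumes "\<And>y. \<bar>c y\<bar> \<le> P * norm y"
  shows "\<bar>prod_list (map c hs)\<bar> \<le> P ^ length hs * prod_list (map norm hs)"
proof (induction hs)
  case (Cons h hs)
  have "\<bar>c h\<bar> * \<bar>prod_list (map c hs)\<bar> \<le> (P * norm h) * (P ^ length hs * prod_list (map norm hs))"
    using assms[of h] Cons by (intro mult_mono) auto
  then show ?case by (simp add: abs_mult mult_ac)
qed simp

lemma mult_norm_le_product: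
  fixes c :: "'a::real_normed_vector \<Rightarrow> real"
  assumes "\<And>y. \<bar>c y\<bar> \<le> P * norm y" and "norm w = 1" and "\<bar>x\<bar> * P ^ l \<le> B"
  shows "mult_norm_le l (\<lambda>hs. (x * prod_list (map c hs)) *\<^sub>R w) B"
  unfolding mult_norm_le_def
proof (intro allI impI)
  fix hs :: "'a list" assume l: "length hs = l"
  have nonneg: "0 \<le> prod_list (map norm hs)"
    by (induction hs) auto
  have "norm ((x * prod_list (map c hs)) *\<^sub>R w) = \<bar>x\<bar> * \<bar>prod_list (map c hs)\<bar>"
    using assms(2) by (simp add: abs_mult)
  also have "\<dots> \<le> \<bar>x\<bar> * (P ^ l * prod_list (map norm hs))"
    using abs_prod_list_le[of c P hs] assms(1) l by (intro mult_left_mono) auto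
  also have "\<dots> = (\<bar>x\<bar> * P ^ l) * prod_list (map norm hs)"
    by simp
  also have "\<dots> \<le> B * prod_list (map norm hs)"
    by (rule mult_right_mono[OF assms(3) nonneg])
  finally show "norm ((x * prod_list (map c hs)) *\<^sub>R w) \<le> B * prod_list (map norm hs)" .
qed

lemma linear_prod_list_update:
  fixes c :: "'a::real_vector \<Rightarrow> real" and w :: "'b::real_vector"
  assumes "linear c" and "i < length hs"
  shows "linear (\<lambda>h. (x * prod_list (map c (hs[i := h]))) *\<^sub>R w)"
proof -
  have "(x * prod_list (map c (hs[i := h]))) *\<^sub>R w =
      c h *\<^sub>R ((x * prod_list (map c (take i hs @ drop (Suc i) hs))) *\<^sub>R w)" for h
    using assms(2) by (simp add: upd_conv_take_nth_drop)
  moreover have "linear (\<lambda>h. c h *\<^sub>R u)" for u :: 'b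
    using assms(1) by (simp add: linear_iff scaleR_left_distrib)
  ultimately show ?thesis
    by presburger
qed

text \<open>
  The \<open>l\<close>-th derivative of \<open>y \<mapsto> v + g 0 (c y) *\<^sub>R w\<close>, where \<open>g l\<close> is the \<open>l\<close>-th derivative of \<open>g 0\<close>.
\<close>

definition ridge_derivative ::
  "('a::real_vector \<Rightarrow> real) \<Rightarrow> 'a \<Rightarrow> 'a \<Rightarrow> (nat \<Rightarrow> real \<Rightarrow> real) \<Rightarrow> nat \<Rightarrow> 'a \<Rightarrow> 'a list \<Rightarrow> 'a" where
  "ridge_derivative c v w g l y hs =
     (if l = 0 then v else 0) + (g l (c y) * prod_list (map c hs)) *\<^sub>R w"

lemma derivatives_on_ridge:
  fixes c :: "'a::real_normed_vector \<Rightarrow> real"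
  assumes c: "linear c" and P: "1 \<le> P" "\<And>y. \<bar>c y\<bar> \<le> P * norm y" and w: "norm w = 1"
    and g: "\<And>l x. l \<le> r \<Longrightarrow> (g l has_real_derivative g (Suc l) x) (at x)"
  shows "derivatives_on S (\<lambda>y. v + g 0 (c y) *\<^sub>R w) r (ridge_derivative c v w g)"
  unfolding derivatives_on_def
proof (intro conjI ballI allI impI)
  fix y show "ridge_derivative c v w g 0 y [] = v + g 0 (c y) *\<^sub>R w"
    by (simp add: ridge_derivative_def)
next
  fix l y
  show "multilinear l (ridge_derivative c v w g l y)"
    unfolding multilinear_def ridge_derivative_def
    using linear_prod_list_update[OF c] by auto
next
  fix l y
  show "\<exists>B. mult_norm_le l (ridge_derivative c v w g l y) B"
  proof (cases "l = 0")
    case True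
    then show ?thesis
      unfolding mult_norm_le_def ridge_derivative_def by (intro exI[of _ "norm (v + g 0 (c y) *\<^sub>R w)"]) simp
  next
    case False
    then show ?thesis
      unfolding ridge_derivative_def using mult_norm_le_product[OF P(2) w] by (auto intro: exI)
  qed
next
  fix l y and \<epsilon> :: real assume "l < r" "\<epsilon> > 0"
  \<comment> \<open>The remainder of \<open>g l\<close> at \<open>c y\<close> gets one factor \<open>P\<close> from \<open>c x - c y\<close> and one from each of the \<open>l\<close> directions.\<close>
  define \<epsilon>' where "\<epsilon>' = \<epsilon> / P ^ Suc l"
  have pos: "0 < P ^ l" "0 < P" using P(1) by auto
  have "\<epsilon>' > 0" unfolding \<epsilon>'_def using \<open>\<epsilon> > 0\<close> P(1) by simp
  have "(g l has_derivative (\<lambda>h. h * g (Suc l) (c y))) (at (c y))"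
    using g[of l "c y"] \<open>l < r\<close> by (simp add: has_field_derivative_def mult_commute_abs)
  then obtain d where d: "d > 0" and
    rem: "\<And>x. \<bar>x - c y\<bar> < d \<Longrightarrow> \<bar>g l x - g l (c y) - (x - c y) * g (Suc l) (c y)\<bar> \<le> \<epsilon>' * \<bar>x - c y\<bar>"
    using \<open>\<epsilon>' > 0\<close> unfolding has_derivative_at_alt by (auto simp: real_norm_def)
  show "\<exists>\<delta>>0. \<forall>x\<in>S. norm (x - y) < \<delta> \<longrightarrow>
      mult_norm_le l (\<lambda>hs. ridge_derivative c v w g l x hs - ridge_derivative c v w g l y hs -
        ridge_derivative c v w g (Suc l) y ((x - y) # hs)) (\<epsilon> * norm (x - y))"
  proof (intro exI[of _ "d / P"] conjI ballI impI)
    show "d / P > 0" using d P(1) by simp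
    fix x assume "norm (x - y) < d / P"
    have diff: "c x - c y = c (x - y)" by (simp add: linear_diff[OF c])
    have "\<bar>c x - c y\<bar> \<le> P * norm (x - y)"
      unfolding diff by (rule P(2))
    then have "\<bar>c x - c y\<bar> < d"
      using \<open>norm (x - y) < d / P\<close> P(1) by (simp add: field_simps)
    define \<rho> where "\<rho> = g l (c x) - g l (c y) - (c x - c y) * g (Suc l) (c y)"
    have "\<bar>\<rho>\<bar> \<le> \<epsilon>' * (P * norm (x - y))"
      using rem[OF \<open>\<bar>c x - c y\<bar> < d\<close>] \<open>\<bar>c x - c y\<bar> \<le> P * norm (x - y)\<close> \<open>\<epsilon>' > 0\<close>
      unfolding \<rho>_def by (meson mult_left_mono less_imp_le order_trans)
    then have "\<bar>\<rho>\<bar> * P ^ l \<le> \<epsilon>' * (P * norm (x - y)) * P ^ l"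
      using pos by (intro mult_right_mono) auto
    also have "\<dots> = \<epsilon> * norm (x - y)"
      unfolding \<epsilon>'_def using pos by (simp add: field_simps)
    finally have "mult_norm_le l (\<lambda>hs. (\<rho> * prod_list (map c hs)) *\<^sub>R w) (\<epsilon> * norm (x - y))"
      by (rule mult_norm_le_product[OF P(2) w])
    moreover have "(\<lambda>hs. ridge_derivative c v w g l x hs - ridge_derivative c v w g l y hs -
        ridge_derivative c v w g (Suc l) y ((x - y) # hs)) = (\<lambda>hs. (\<rho> * prod_list (map c hs)) *\<^sub>R w)"
      unfolding ridge_derivative_def \<rho>_def diff
      by (auto simp: fun_eq_iff algebra_simps)
    ultimately show "mult_norm_le l (\<lambda>hs. ridge_derivative c v w g l x hs -
        ridge_derivative c v w g l y hs - ridge_derivative c v w g (Suc l) y ((x - y) # hs))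
        (\<epsilon> * norm (x - y))"
      by simp
  qed
next
  fix y and \<epsilon> :: real assume "\<epsilon> > 0"
  have pos: "0 < P ^ r" "0 < P" using P(1) by auto
  have "isCont (g r) (c y)"
    using g[of r "c y"] DERIV_isCont by blast
  then obtain d where d: "d > 0" and
    near: "\<And>x. \<bar>x - c y\<bar> < d \<Longrightarrow> \<bar>g r x - g r (c y)\<bar> < \<epsilon> / P ^ r"
    using divide_pos_pos[OF \<open>\<epsilon> > 0\<close> pos(1)]
    unfolding continuous_at_eps_delta dist_real_def by blast
  show "\<exists>\<delta>>0. \<forall>x\<in>S. norm (x - y) < \<delta> \<longrightarrow>
      mult_norm_le r (\<lambda>hs. ridge_derivative c v w g r x hs - ridge_derivative c v w g r y hs) \<epsilon>"
  proof (intro exI[of _ "d / P"] conjI ballI impI)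
    show "d / P > 0" using d P(1) by simp
    fix x assume "norm (x - y) < d / P"
    have diff: "c x - c y = c (x - y)" by (simp add: linear_diff[OF c])
    have "\<bar>c x - c y\<bar> \<le> P * norm (x - y)"
      unfolding diff by (rule P(2))
    then have "\<bar>c x - c y\<bar> < d"
      using \<open>norm (x - y) < d / P\<close> P(1) by (simp add: field_simps)
    from near[OF this] have "\<bar>g r (c x) - g r (c y)\<bar> * P ^ r \<le> \<epsilon>"
      using pos by (simp add: field_simps)
    then have "mult_norm_le r (\<lambda>hs. ((g r (c x) - g r (c y)) * prod_list (map c hs)) *\<^sub>R w) \<epsilon>"
      by (rule mult_norm_le_product[OF P(2) w])
    moreover have "(\<lambda>hs. ridge_derivative c v w g r x hs - ridge_derivative c v w g r y hs) =
        (\<lambda>hs. ((g r (c x) - g r (c y)) * prod_list (map c hs)) *\<^sub>R w)"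
      unfolding ridge_derivative_def by (auto simp: fun_eq_iff algebra_simps)
    ultimately show "mult_norm_le r (\<lambda>hs. ridge_derivative c v w g r x hs -
        ridge_derivative c v w g r y hs) \<epsilon>"
      by simp
  qed
qed

lemma ridge_in_class_F:
  fixes e :: "nat \<Rightarrow> 'a::real_normed_vector"
  assumes c: "linear c" and P: "1 \<le> P" "\<And>y. \<bar>c y\<bar> \<le> P * norm y" and w: "norm w = 1"
    and g: "\<And>l x. l \<le> max r 1 \<Longrightarrow> (g l has_real_derivative g (Suc l) x) (at x)"
    and lip: "\<And>x. \<bar>g 1 x\<bar> * P \<le> L"
    and D: "\<And>l x. 1 \<le> l \<Longrightarrow> l \<le> r \<Longrightarrow> \<bar>g l x\<bar> * P ^ l \<le> D"
    and init: "\<And>k. 1 \<le> k \<Longrightarrow> norm (\<eta> - proj e k \<eta>) \<le> \<gamma> k"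
    and M: "norm (v + g 0 (c \<eta>) *\<^sub>R w) \<le> M"
    and tail: "\<And>k y. 1 \<le> k \<Longrightarrow>
      norm (v + g 0 (c y) *\<^sub>R w - proj e k (v + g 0 (c y) *\<^sub>R w)) \<le> \<delta> k"
  shows "((\<lambda>y. v + g 0 (c y) *\<^sub>R w), \<eta>) \<in> class_F e r L M D \<gamma> \<delta> R"
proof -
  have "L-lipschitz_on UNIV (\<lambda>y. v + g 0 (c y) *\<^sub>R w)"
  proof (rule lipschitz_onI)
    have "0 \<le> \<bar>g 1 0\<bar> * P" using P(1) by simp
    then show "0 \<le> L" using lip[of 0] by linarith
    fix x y
    have "\<bar>g 1 z\<bar> \<le> L / P" for z
      using lip[of z] P(1) by (simp add: field_simps)
    then have "\<bar>g 0 (c x) - g 0 (c y)\<bar> \<le> L / P * \<bar>c x - c y\<bar>"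
      using field_differentiable_bound[of UNIV "g 0" "g 1" "L / P" "c x" "c y"] g[of 0] by simp
    also have "\<dots> \<le> L / P * (P * norm (x - y))"
      using P(2)[of "x - y"] \<open>0 \<le> L\<close> P(1) by (intro mult_left_mono) (auto simp: linear_diff[OF c])
    finally have "\<bar>g 0 (c x) - g 0 (c y)\<bar> \<le> L * norm (x - y)"
      using P(1) by simp
    then show "dist (v + g 0 (c x) *\<^sub>R w) (v + g 0 (c y) *\<^sub>R w) \<le> L * dist x y"
      using w by (simp add: dist_norm flip: scaleR_diff_left)
  qed
  moreover have "derivatives_on (cball \<eta> R) (\<lambda>y. v + g 0 (c y) *\<^sub>R w) r (ridge_derivative c v w g)"
    by (rule derivatives_on_ridge[OF c P w]) (simp add: g)
  moreover have "mult_norm_le l (ridge_derivative c v w g l y) D" if "l \<in> {1..r}" for l y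
  proof -
    have "ridge_derivative c v w g l y = (\<lambda>hs. (g l (c y) * prod_list (map c hs)) *\<^sub>R w)"
      using that by (auto simp: fun_eq_iff ridge_derivative_def)
    then show ?thesis
      using mult_norm_le_product[OF P(2) w D] that by simp
  qed
  ultimately show ?thesis
    unfolding class_F_def basic_class_def using init M tail
    by (simp only: mem_Collect_eq case_prod_conv) blast
qed

lemma constant_in_class_F:
  fixes e :: "nat \<Rightarrow> 'a::real_normed_vector"
  assumes e: "schauder_basis e" "norm (e 1) = 1" and P: "1 \<le> P" "\<And>y. \<bar>coord e y 0\<bar> \<le> P * norm y"
    and "0 \<le> L" and "0 \<le> D"
    and "\<And>k. 1 \<le> k \<Longrightarrow> norm (\<eta> - proj e k \<eta>) \<le> \<gamma> k" and "norm v \<le> M"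
    and "\<And>k. 1 \<le> k \<Longrightarrow> norm (v - proj e k v) \<le> \<delta> k"
  shows "((\<lambda>y. v), \<eta>) \<in> class_F e r L M D \<gamma> \<delta> R"
  using ridge_in_class_F[OF linear_coord[OF e(1)] P e(2), where g = "\<lambda>_ _. 0" and v = v] assms
  by simp

lemma solves_ivp_affine: "solves_ivp (\<lambda>_. v) a b \<eta> (\<lambda>t. \<eta> + (t - a) *\<^sub>R v)"
  unfolding solves_ivp_def by (auto intro!: derivative_eq_intros)

section \<open>Lower bound for the truncation parameter\<close>

lemma norm_tail_basis:
  assumes "schauder_basis e" and "norm (e N) = 1" and "1 \<le> N"
    and "positive_nonincreasing_null g" and "0 \<le> x" and "x \<le> g N" and "1 \<le> k"
  shows "norm (x *\<^sub>R e N - proj e k (x *\<^sub>R e N)) \<le> g k"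
proof (cases "N < k")
  case True
  then show ?thesis
    using assms(1,4,7) by (simp add: proj_basis positive_nonincreasing_null_def less_imp_le)
next
  case False
  have "g N \<le> g k"
    using False assms(4,7) unfolding positive_nonincreasing_null_def nonincreasing_null_def
    by (intro dec_induct[of k N "\<lambda>i. g i \<le> g k"]) (auto intro: order_trans)
  then show ?thesis
    using False assms by (simp add: proj_basis)
qed

text \<open>
  As the coordinates are numbered from \<open>0\<close>, the truncation to \<open>N\<close> coordinates maps \<open>e N\<close> to \<open>0\<close>.
  For the zero right-hand side, the initial values \<open>0\<close> and \<open>\<gamma> N *\<^sub>R e N\<close> therefore produce the same
  information, and the solutions stay at these initial values.
\<close>

lemma initial_tail_le_error:
  fixes e :: "nat \<Rightarrow> 'a::banach"
  assumes e: "schauder_basis e" "\<And>j. norm (e j) = 1" "basis_constant e < \<infinity>"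
    and ab: "a < b" and "L > 0" and "M > 0" and "D > 0"
    and \<gamma>: "positive_nonincreasing_null \<gamma>" and \<delta>: "positive_nonincreasing_null \<delta>"
    and N: "1 \<le> trunc I"
    and err: "algorithm_error e a b (class_F e r L M D \<gamma> \<delta> R) \<phi> I \<le> ereal \<epsilon>"
  shows "\<gamma> (trunc I) \<le> 2 * \<epsilon>"
proof -
  obtain P where P: "1 \<le> P" "\<And>y. \<bar>coord e y 0\<bar> \<le> P * norm y"
    using bounded_first_coord[of e] e by metis
  define N where "N = trunc I"
  define \<eta> where "\<eta> = \<gamma> N *\<^sub>R e N"
  have pos: "0 < \<gamma> k" "0 < \<delta> k" if "1 \<le> k" for k
    using \<gamma> \<delta> that by (auto simp: positive_nonincreasing_null_def)
  have proj0: "proj e k 0 = 0" for k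
    by (rule linear_0[OF linear_proj[OF e(1)]])
  have tail: "norm (\<eta> - proj e k \<eta>) \<le> \<gamma> k" if "1 \<le> k" for k
    unfolding \<eta>_def using that N pos
    by (intro norm_tail_basis e \<gamma>) (auto simp: N_def less_imp_le)
  have "((\<lambda>_. 0), 0) \<in> class_F e r L M D \<gamma> \<delta> R"
    by (rule constant_in_class_F[OF e(1,2) P])
      (use assms pos proj0 in \<open>auto simp: less_imp_le\<close>)
  moreover have "((\<lambda>_. 0), \<eta>) \<in> class_F e r L M D \<gamma> \<delta> R"
    by (rule constant_in_class_F[OF e(1,2) P])
      (use assms pos proj0 tail in \<open>auto simp: less_imp_le\<close>)
  moreover have "information_value e I (\<lambda>_. 0) 0 = information_value e I (\<lambda>_. 0) \<eta>"
    by (intro information_value_cong) (simp_all add: proj0 \<eta>_def proj_basis[OF e(1)] N_def)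
  ultimately have "norm (0 - \<eta>) \<le> 2 * \<epsilon>"
    using indistinguishable_solutions_close[OF err _ _
        solves_ivp_affine[of 0 a b 0] solves_ivp_affine[of 0 a b \<eta>], of b] ab by simp
  then show ?thesis
    using e(2) pos[of N] N by (simp add: \<eta>_def N_def)
qed

text \<open>
  Queries concern components with index below \<open>N\<close> only, and these vanish both for the right-hand
  side \<open>0\<close> and for the constant one \<open>min (\<delta> N) M *\<^sub>R e N\<close>. The minimum keeps the norm of the latter
  within the bound \<open>M\<close>.
\<close>

lemma rhs_tail_le_error:
  fixes e :: "nat \<Rightarrow> 'a::banach"
  assumes e: "schauder_basis e" "\<And>j. norm (e j) = 1" "basis_constant e < \<infinity>"
    and ab: "a < b" and "L > 0" and "M > 0" and "D > 0"
    and \<gamma>: "positive_nonincreasing_null \<gamma>" and \<delta>: "positive_nonincreasing_null \<delta>"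
    and I: "I \<in> valid_information e r Khat (class_F e r L M D \<gamma> \<delta> R)"
    and err: "algorithm_error e a b (class_F e r L M D \<gamma> \<delta> R) \<phi> I \<le> ereal \<epsilon>"
  shows "min (\<delta> (trunc I)) M * (b - a) \<le> 2 * \<epsilon>"
proof -
  obtain P where P: "1 \<le> P" "\<And>y. \<bar>coord e y 0\<bar> \<le> P * norm y"
    using bounded_first_coord[of e] e by metis
  define N where "N = trunc I"
  define v where "v = min (\<delta> N) M *\<^sub>R e N"
  have N: "1 \<le> N"
    using I by (auto simp: valid_information_def N_def)
  have pos: "0 < \<gamma> k" "0 < \<delta> k" if "1 \<le> k" for k
    using \<gamma> \<delta> that by (auto simp: positive_nonincreasing_null_def)
  have proj0: "proj e k 0 = 0" for k
    by (rule linear_0[OF linear_proj[OF e(1)]])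
  have tail: "norm (v - proj e k v) \<le> \<delta> k" if "1 \<le> k" for k
    unfolding v_def using that N pos[OF N] \<open>M > 0\<close>
    by (intro norm_tail_basis e \<delta>) auto
  have norm_v: "norm v = min (\<delta> N) M"
    using e(2) pos[OF N] \<open>M > 0\<close> by (simp add: v_def)
  have zero: "((\<lambda>_. 0), 0) \<in> class_F e r L M D \<gamma> \<delta> R"
    by (rule constant_in_class_F[OF e(1,2) P])
      (use assms pos proj0 in \<open>auto simp: less_imp_le\<close>)
  have const: "((\<lambda>_. v), 0) \<in> class_F e r L M D \<gamma> \<delta> R"
    by (rule constant_in_class_F[OF e(1,2) P])
      (use assms pos proj0 tail norm_v in \<open>auto simp: less_imp_le\<close>)
  have "information_value e I (\<lambda>_. 0) 0 = information_value e I (\<lambda>_. v) 0"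
  proof (rule information_value_cong)
    fix i assume "i < total_evals I"
    obtain y j "is" where q: "asked e I (\<lambda>_. 0) 0 i = (y, j, is)"
      by (metis surj_pair)
    then have "j < N"
      using I zero \<open>i < total_evals I\<close> by (fastforce simp: valid_information_def N_def)
    then have "coord e 0 j = coord e v j"
      using linear_0[OF linear_coord[OF e(1)]] linear_scale[OF linear_coord[OF e(1)]]
      by (simp add: v_def coord_basis[OF e(1)])
    then show "answer e (trunc I) (\<lambda>_. 0) (asked e I (\<lambda>_. 0) 0 i) =
        answer e (trunc I) (\<lambda>_. v) (asked e I (\<lambda>_. 0) 0 i)"
      by (simp add: answer_def q)
  qed simp
  from indistinguishable_solutions_close[OF err zero const
      solves_ivp_affine[of 0 a b 0] solves_ivp_affine[of v a b 0] this, of b]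
  show ?thesis
    using ab norm_v by (simp add: N_def mult.commute)
qed

section \<open>Bumps with prescribed support\<close>

text \<open>
  For \<open>l \<le> p\<close>, \<open>sine_power p l\<close> is the \<open>l\<close>-th derivative of the \<open>p\<close>-th power of the sine. The factor
  \<open>sin x ^ (p - l)\<close> is kept apart to make visible that it vanishes at all multiples of \<open>pi\<close>
  for \<open>l < p\<close>; differentiating \<open>sin x ^ k * q (cos x)\<close> and replacing the square of the sine gives
  the recursion for the polynomial factor.
\<close>

primrec cos_factor :: "nat \<Rightarrow> nat \<Rightarrow> real poly" where
  "cos_factor p 0 = 1"
| "cos_factor p (Suc l) =
     smult (real (p - l)) (pCons 0 (cos_factor p l)) - [:1, 0, -1:] * pderiv (cos_factor p l)"

definition sine_power :: "nat \<Rightarrow> nat \<Rightarrow> real \<Rightarrow> real" where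
  "sine_power p l x = sin x ^ (p - l) * poly (cos_factor p l) (cos x)"

lemma sine_power_has_derivative:
  assumes "l < p"
  shows "(sine_power p l has_real_derivative sine_power p (Suc l) x) (at x)"
proof -
  let ?q = "cos_factor p l"
  obtain m where m: "p - l = Suc m" "p - Suc l = m"
    using assms by (metis Suc_diff_Suc)
  have "((\<lambda>x. sin x ^ Suc m * poly ?q (cos x)) has_real_derivative
      real (Suc m) * sin x ^ m * cos x * poly ?q (cos x) +
      sin x ^ Suc m * (poly (pderiv ?q) (cos x) * - sin x)) (at x)"
    by (rule derivative_eq_intros poly_DERIV[THEN DERIV_chain2] refl | simp)+
  moreover have "sine_power p (Suc l) x = real (Suc m) * sin x ^ m * cos x * poly ?q (cos x) +
      sin x ^ Suc m * (poly (pderiv ?q) (cos x) * - sin x)"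
  proof -
    have "poly [:1, 0, -1:] (cos x) = sin x * sin x"
      using sin_squared_eq[of x] by (simp add: power2_eq_square)
    then show ?thesis
      unfolding sine_power_def m cos_factor.simps poly_diff poly_mult
      by (simp only: m poly_smult poly_pCons) (simp add: algebra_simps)
  qed
  ultimately show ?thesis
    unfolding sine_power_def[abs_def] m by simp
qed

lemma sine_power_bounded: "\<exists>B. \<forall>x. \<bar>sine_power p l x\<bar> \<le> B"
proof -
  have "bounded (poly (cos_factor p l) ` {-1..1})"
    by (intro compact_imp_bounded compact_continuous_image continuous_intros) auto
  then obtain B where B: "\<And>u. u \<in> {-1..1} \<Longrightarrow> \<bar>poly (cos_factor p l) u\<bar> \<le> B"
    unfolding bounded_iff real_norm_def by blast
  have "\<bar>sine_power p l x\<bar> \<le> 1 * B" for x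
    unfolding sine_power_def abs_mult power_abs
    by (intro mult_mono power_le_one B) auto
  then show ?thesis by auto
qed

lemma sine_power_uniformly_bounded:
  obtains B where "0 < B" and "\<And>l x. l \<le> s \<Longrightarrow> \<bar>sine_power p l x\<bar> \<le> B"
proof -
  obtain B where B: "\<And>l x. \<bar>sine_power p l x\<bar> \<le> B l"
    using sine_power_bounded[of p] by metis
  have nonneg: "0 \<le> B l" for l
    using B[of l 0] by linarith
  have "\<bar>sine_power p l x\<bar> \<le> 1 + (\<Sum>l\<le>s. B l)" if "l \<le> s" for l x
    using B[of l x] member_le_sum[of l "{..s}" B] nonneg that by auto
  moreover have "0 < 1 + (\<Sum>l\<le>s. B l)"
    using sum_nonneg[of "{..s}" B] nonneg by auto
  ultimately show thesis using that by blast
qed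

text \<open>
  Cells have length \<open>pi\<close>, so that their endpoints are the zeros of the sine and the bumps are whole
  arches of a power of the sine.
\<close>

definition cells :: "nat set \<Rightarrow> real set" where
  "cells S = (\<Union>k\<in>S. {real k * pi..real (Suc k) * pi})"

definition bumps :: "nat \<Rightarrow> nat set \<Rightarrow> nat \<Rightarrow> real \<Rightarrow> real" where
  "bumps p S l x = (if x \<in> cells S then sine_power p l x else 0)"

lemma closed_cells: "finite S \<Longrightarrow> closed (cells S)"
  unfolding cells_def by auto

lemma cells_interior:
  assumes "x \<in> cells S" and "sin x \<noteq> 0"
  shows "x \<in> interior (cells S)"
proof -
  obtain k where k: "k \<in> S" "real k * pi \<le> x" "x \<le> real (Suc k) * pi"
    using assms(1) unfolding cells_def by auto
  have "x \<noteq> real k * pi" "x \<noteq> real (Suc k) * pi"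
    using assms(2) sin_npi[of k] sin_npi[of "Suc k"] by metis+
  with k have "x \<in> {real k * pi<..<real (Suc k) * pi}" by auto
  moreover have "{real k * pi<..<real (Suc k) * pi} \<subseteq> cells S"
    using k(1) unfolding cells_def by fastforce
  ultimately show ?thesis
    by (meson interiorI open_greaterThanLessThan)
qed

text \<open>
  Cutting off at the boundary of the cells does no harm: there the derivatives of order \<open>l\<close> and
  \<open>Suc l\<close> of the full power of the sine both vanish, and the cut-off function is dominated by the
  full one.
\<close>

lemma bumps_has_derivative:
  assumes "finite S" and "Suc l < p"
  shows "(bumps p S l has_real_derivative bumps p S (Suc l) x) (at x)"
proof -
  have deriv: "(sine_power p l has_real_derivative sine_power p (Suc l) x) (at x)"
    using assms(2) by (intro sine_power_has_derivative) simp
  consider "x \<notin> cells S" | "x \<in> cells S" "sin x \<noteq> 0" | "sin x = 0" by blast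
  then show ?thesis
  proof cases
    case 1
    have "((\<lambda>_. 0) has_real_derivative 0) (at x)" by simp
    then have "(bumps p S l has_real_derivative 0) (at x)"
      by (rule has_field_derivative_transform_within_open[where S = "- cells S"])
        (use 1 closed_cells[OF assms(1)] in \<open>auto simp: bumps_def\<close>)
    with 1 show ?thesis by (simp add: bumps_def)
  next
    case 2
    have "(bumps p S l has_real_derivative sine_power p (Suc l) x) (at x)"
      by (rule has_field_derivative_transform_within_open[OF deriv, where S = "interior (cells S)"])
        (use cells_interior[OF 2] interior_subset in \<open>auto simp: bumps_def\<close>)
    with 2 show ?thesis by (simp add: bumps_def)
  next
    case 3
    then have zero: "sine_power p l x = 0" "sine_power p (Suc l) x = 0"
      using assms(2) by (auto simp: sine_power_def)
    have "((\<lambda>y. sine_power p l y / (y - x)) \<longlongrightarrow> 0) (at x)"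
      using deriv zero unfolding has_field_derivative_iff by simp
    then have "((\<lambda>y. bumps p S l y / (y - x)) \<longlongrightarrow> 0) (at x)"
      by (rule Lim_null_comparison[rotated, OF tendsto_norm_zero])
        (auto simp: bumps_def)
    then show ?thesis
      using zero unfolding has_field_derivative_iff by (simp add: bumps_def)
  qed
qed

lemma bumps_bound:
  assumes "\<And>x. \<bar>sine_power p l x\<bar> \<le> B"
  shows "\<bar>bumps p S l x\<bar> \<le> B"
  using assms[of x] by (auto simp: bumps_def)

lemma integral_sin_power_pos: "0 < integral {0..pi} (\<lambda>x. sin x ^ p)"
proof -
  have nonneg: "0 \<le> sin x ^ p" if "x \<in> {0..pi}" for x
    using that by (auto intro: zero_le_power sin_ge_zero)
  have cont: "continuous_on {0..pi} (\<lambda>x. sin x ^ p)"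
    by (intro continuous_intros)
  have "integral {0..pi} (\<lambda>x. sin x ^ p) \<noteq> 0"
    using integral_eq_0_iff[OF cont pi_gt_zero nonneg] 
    by (auto intro!: bexI[of _ "pi/2"])
  moreover have "0 \<le> integral {0..pi} (\<lambda>x. sin x ^ p)"
    using nonneg by (intro integral_nonneg integrable_continuous_interval cont) auto
  ultimately show ?thesis by simp
qed

lemma sin_power_shift:
  assumes "even p"
  shows "sin (x + real k * pi) ^ p = sin x ^ p"
proof -
  have "sin (x + real k * pi) = (- 1) ^ k * sin x"
    by (simp add: sin_add cos_npi sin_npi)
  then show ?thesis
    using assms by (simp add: power_mult_distrib flip: power_mult)
qed

lemma has_integral_cell:
  assumes "even p"
  shows "((\<lambda>x. sin x ^ p) has_integral integral {0..pi} (\<lambda>x. sin x ^ p))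
    {real k * pi..real (Suc k) * pi}"
proof -
  have int: "((\<lambda>x. sin x ^ p) has_integral integral {0..pi} (\<lambda>x. sin x ^ p)) {0..pi}"
    by (intro integrable_integral integrable_continuous_interval continuous_intros)
  have "((\<lambda>x. sin (x - real k * pi) ^ p) has_integral integral {0..pi} (\<lambda>x. sin x ^ p))
      ((\<lambda>x. x + real k * pi) ` {0..pi})"
    using has_integral_affinity[OF int[folded cbox_interval], of 1 "- (real k * pi)"]
    by (simp add: algebra_simps)
  moreover have "(\<lambda>x. x + real k * pi) ` {0..pi} = {real k * pi..real (Suc k) * pi}"
    by (simp add: algebra_simps)
  moreover have "sin (x - real k * pi) ^ p = sin x ^ p" for x
    using sin_power_shift[OF assms, of "x - real k * pi" k] by simp
  ultimately show ?thesis by simp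
qed

text \<open>
  The exponent is even, so that all arches have the same sign and equal integrals, and positive, so
  that the arches vanish where neighbouring cells overlap.
\<close>

lemma integral_bumps:
  assumes "even p" and "0 < p" and "S \<subseteq> {..<K}"
  shows "integral {0..real K * pi} (bumps p S 0) =
    real (card S) * integral {0..pi} (\<lambda>x. sin x ^ p)"
proof -
  define cell where "cell k = {real k * pi..real (Suc k) * pi}" for k
  have fin: "finite S" using assms(3) finite_subset by blast
  have "((\<lambda>x. if x \<in> cell k then sin x ^ p else 0) has_integral
      integral {0..pi} (\<lambda>x. sin x ^ p)) {0..real K * pi}" if "k \<in> S" for k
  proof -
    have "real (Suc k) * pi \<le> real K * pi"
      using that assms(3) by (intro mult_right_mono) auto
    then have "cell k \<subseteq> {0..real K * pi}"
      unfolding cell_def by (auto intro: order_trans[of 0 "real k * pi"])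
    then show ?thesis
      using has_integral_cell[OF assms(1), of k] unfolding cell_def[symmetric]
      by (simp only: has_integral_restrict)
  qed
  then have "((\<lambda>x. \<Sum>k\<in>S. if x \<in> cell k then sin x ^ p else 0) has_integral
      (\<Sum>k\<in>S. integral {0..pi} (\<lambda>x. sin x ^ p))) {0..real K * pi}"
    using fin by (intro has_integral_sum) auto
  moreover have "(\<Sum>k\<in>S. if x \<in> cell k then sin x ^ p else 0) = bumps p S 0 x" for x
  proof (cases "sin x = 0")
    case True
    then have "(\<Sum>k\<in>S. if x \<in> cell k then sin x ^ p else 0) = 0"
      using assms(2) by (intro sum.neutral) auto
    with True assms(2) show ?thesis by (simp add: bumps_def sine_power_def)
  next
    case False
    have uniq: "k = k'" if "x \<in> cell k" "x \<in> cell k'" for k k'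
    proof (rule ccontr)
      assume "k \<noteq> k'"
      have *: False if "i < j" "x \<in> cell i" "x \<in> cell j" for i j
      proof -
        have "real (Suc i) * pi \<le> real j * pi"
          using that(1) by (intro mult_right_mono) auto
        with that(2,3) have "x = real j * pi"
          unfolding cell_def atLeastAtMost_iff by linarith
        then show False using False sin_npi by simp
      qed
      show False using * that \<open>k \<noteq> k'\<close> by (metis linorder_neqE_nat)
    qed
    show ?thesis
    proof (cases "\<exists>k\<in>S. x \<in> cell k")
      case True
      then obtain k where k: "k \<in> S" "x \<in> cell k" by blast
      have "(\<Sum>k\<in>S. if x \<in> cell k then sin x ^ p else 0) =
          (\<Sum>i\<in>S. if i = k then sin x ^ p else 0)"
        by (intro sum.cong) (use uniq k in auto)
      then show ?thesis
        using k fin by (auto simp: bumps_def cells_def cell_def sine_power_def)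
    next
      case False
      then show ?thesis by (auto simp: bumps_def cells_def cell_def intro!: sum.neutral)
    qed
  qed
  ultimately show ?thesis by (simp add: integral_unique)
qed

text \<open>
  A point lies in at most two cells, as neighbouring cells share an endpoint.
\<close>

lemma free_cells:
  assumes "finite X"
  shows "K - 2 * card X \<le> card {k. k < K \<and> (\<forall>x\<in>X. x \<notin> {real k * pi..real (Suc k) * pi})}"
    (is "_ \<le> card ?S")
proof -
  define hit where "hit x = {k. x \<in> {real k * pi..real (Suc k) * pi}}" for x
  have hit: "hit x \<subseteq> {nat \<lfloor>x / pi\<rfloor>, nat \<lfloor>x / pi\<rfloor> - 1}" for x
  proof
    fix k assume "k \<in> hit x"
    then have "real k \<le> x / pi" "x / pi \<le> real (Suc k)"
      by (auto simp: hit_def field_simps)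
    then have "int k \<le> \<lfloor>x / pi\<rfloor>" "\<lfloor>x / pi\<rfloor> \<le> int (Suc k)"
      by linarith+
    then show "k \<in> {nat \<lfloor>x / pi\<rfloor>, nat \<lfloor>x / pi\<rfloor> - 1}" by auto
  qed
  then have fin: "finite (hit x)" for x
    by (rule finite_subset) simp
  have card: "card (hit x) \<le> 2" for x
    using card_mono[OF _ hit[of x]] card_insert_le_m1[of 2 "{nat \<lfloor>x / pi\<rfloor> - 1}" "nat \<lfloor>x / pi\<rfloor>"]
    by simp
  have "{..<K} \<subseteq> ?S \<union> (\<Union>x\<in>X. hit x)"
    by (auto simp: hit_def)
  then have "K \<le> card (?S \<union> (\<Union>x\<in>X. hit x))"
    using card_mono[of "?S \<union> (\<Union>x\<in>X. hit x)" "{..<K}"] assms fin by auto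
  also have "\<dots> \<le> card ?S + card (\<Union>x\<in>X. hit x)"
    by (rule card_Un_le)
  also have "card (\<Union>x\<in>X. hit x) \<le> (\<Sum>x\<in>X. card (hit x))"
    by (rule card_UN_le[OF assms])
  also have "\<dots> \<le> 2 * card X"
    using sum_bounded_above[of X "\<lambda>x. card (hit x)" 2] card by simp
  finally show ?thesis by simp
qed

section \<open>Lower bound for the number of time steps\<close>

text \<open>
  The first coordinate grows with speed \<open>m\<close>, so that the second component is an integral of the
  ridge profile along the interval swept by the first one. The antiderivative \<open>\<Psi>\<close> is taken in the
  scaled variable \<open>\<omega> * m * (t - a)\<close>, which gives the factor \<open>1 / (\<omega> * m)\<close>.
\<close>

lemma solves_ivp_ridge:
  assumes e: "schauder_basis e" and "0 < m" and "0 < \<omega>" and "\<Psi> 0 = 0"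
    and \<Psi>: "\<And>u. u \<in> {0..\<omega> * m * (b - a)} \<Longrightarrow>
      (\<Psi> has_real_derivative h u) (at u within {0..\<omega> * m * (b - a)})"
  shows "solves_ivp (\<lambda>y. m *\<^sub>R e 0 + (A * h (\<omega> * coord e y 0)) *\<^sub>R e 1) a b 0
    (\<lambda>t. ((t - a) * m) *\<^sub>R e 0 + (A / (\<omega> * m) * \<Psi> (\<omega> * m * (t - a))) *\<^sub>R e 1)"
    (is "solves_ivp ?f a b 0 ?z")
  unfolding solves_ivp_def
proof (intro conjI ballI)
  show "?z a = 0" using \<open>\<Psi> 0 = 0\<close> by simp
  fix t assume t: "t \<in> {a..b}"
  let ?i = "\<lambda>t. \<omega> * m * (t - a)"
  have pos: "0 < \<omega> * m" using assms by simp
  have sub: "?i ` {a..b} \<subseteq> {0..\<omega> * m * (b - a)}"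
    using pos by (auto intro!: mult_left_mono)
  have "(\<Psi> has_real_derivative h (?i t)) (at (?i t) within ?i ` {a..b})"
  proof (rule has_field_derivative_subset[OF _ sub])
    show "(\<Psi> has_real_derivative h (?i t)) (at (?i t) within {0..\<omega> * m * (b - a)})"
      using sub t by (intro \<Psi>) blast
  qed
  moreover have "(?i has_real_derivative \<omega> * m) (at t within {a..b})"
    by (auto intro!: derivative_eq_intros)
  ultimately have "(\<Psi> \<circ> ?i has_real_derivative h (?i t) * (\<omega> * m)) (at t within {a..b})"
    by (rule DERIV_image_chain)
  then have "((\<lambda>t. A / (\<omega> * m) * \<Psi> (?i t)) has_real_derivative
      A / (\<omega> * m) * (h (?i t) * (\<omega> * m))) (at t within {a..b})"
    unfolding comp_def by (rule DERIV_cmult)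
  then have 1: "((\<lambda>t. A / (\<omega> * m) * \<Psi> (?i t)) has_real_derivative A * h (?i t)) (at t within {a..b})"
    using assms(2,3) by simp
  have 2: "((\<lambda>t. (t - a) * m) has_real_derivative m) (at t within {a..b})"
    by (auto intro!: derivative_eq_intros)
  have "coord e (?z t) 0 = (t - a) * m"
    by (simp add: linear_add[OF linear_coord[OF e]] linear_scale[OF linear_coord[OF e]]
        coord_basis[OF e])
  then have "?f (?z t) = m *\<^sub>R e 0 + (A * h (?i t)) *\<^sub>R e 1"
    by (simp add: mult_ac)
  moreover have "(?z has_vector_derivative m *\<^sub>R e 0 + (A * h (?i t)) *\<^sub>R e 1) (at t within {a..b})"
    using has_vector_derivative_add[OF
        has_vector_derivative_scaleR[OF 2 has_vector_derivative_const[of "e 0"]]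
        has_vector_derivative_scaleR[OF 1 has_vector_derivative_const[of "e 1"]]]
    by simp
  ultimately show "(?z has_vector_derivative ?f (?z t)) (at t within {a..b})"
    by (simp only:)
qed

text \<open>
  With \<open>f1\<close> the constant right-hand side and \<open>f2\<close> its perturbation by bumps, the amplitude \<open>A\<close> is chosen
  such that all derivatives of the profile up to the order \<open>s\<close>, multiplied by the
  powers of \<open>P\<close> that come from the first coordinate functional, stay below the smallest bound \<open>D'\<close>
  of the class. The order \<open>s = max r 1\<close> includes the first derivative for \<open>r = 0\<close>, because of the
  Lipschitz condition.
\<close>

lemma error_times_steps_power_bounded_below:
  fixes e :: "nat \<Rightarrow> 'a::banach"
  assumes e: "schauder_basis e" "\<And>j. norm (e j) = 1" "basis_constant e < \<infinity>"
    and ab: "a < b" and "L > 0" and "M > 0" and "D > 0"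
    and \<gamma>: "positive_nonincreasing_null \<gamma>" and \<delta>: "positive_nonincreasing_null \<delta>"
  obtains q where "0 < q"
    and "\<And>I \<phi> \<epsilon>. I \<in> valid_information e r Khat (class_F e r L M D \<gamma> \<delta> R) \<Longrightarrow>
      algorithm_error e a b (class_F e r L M D \<gamma> \<delta> R) \<phi> I \<le> ereal \<epsilon> \<Longrightarrow>
      q \<le> \<epsilon> * real (steps I) ^ max r 1"
proof -
  obtain P where P: "1 \<le> P" "\<And>y. \<bar>coord e y 0\<bar> \<le> P * norm y"
    using bounded_first_coord[of e] e by metis
  define s where "s = max r 1"
  \<comment> \<open>Even, and large enough for derivatives of the bumps up to the order \<open>s + 1\<close>.\<close>
  define p where "p = 2 * s + 2"
  define m where "m = M / 2"
  define X where "X = m * (b - a)"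
  define W where "W = integral {0..pi} (\<lambda>x. sin x ^ p)"
  define D' where "D' = min (min D L) (min m (\<delta> 1))"
  \<comment> \<open>The \<open>Q * n\<close> cells are at least four times as many as the information points, so that at least
    half of them stay free, and \<open>Q \<ge> X / pi\<close> makes the scaling factor \<open>\<omega>\<close> at least \<open>1\<close>.\<close>
  define Q where "Q = nat \<lceil>max (4 * Khat) (X / pi)\<rceil> + 1"
  define \<kappa> where "\<kappa> = P * (real Q * pi / X)"
  obtain B where B: "0 < B" "\<And>l x. l \<le> s \<Longrightarrow> \<bar>sine_power p l x\<bar> \<le> B"
    using sine_power_uniformly_bounded[of s p] by metis
  define q where "q = D' * W * (b - a) / (4 * pi * B * \<kappa> ^ s)"
  have "0 < m" "0 < X"
    using ab \<open>M > 0\<close> by (auto simp: m_def X_def)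
  have "0 < W" unfolding W_def by (rule integral_sin_power_pos)
  have \<delta>_pos: "0 < \<delta> k" and \<gamma>_pos: "0 < \<gamma> k" if "1 \<le> k" for k
    using \<gamma> \<delta> that by (auto simp: positive_nonincreasing_null_def)
  have D': "0 < D'" "D' \<le> D" "D' \<le> L" "D' \<le> m" "D' \<le> \<delta> 1"
    using \<open>0 < m\<close> assms(5,7) \<delta>_pos[of 1] by (auto simp: D'_def)
  have "max (4 * Khat) (X / pi) \<le> real Q"
    unfolding Q_def by linarith
  then have Q: "4 * Khat \<le> real Q" "X / pi \<le> real Q" by auto
  have "0 < real Q" by (simp add: Q_def)
  have "0 < \<kappa>"
    using P(1) \<open>0 < X\<close> \<open>0 < real Q\<close> by (simp add: \<kappa>_def)
  let ?F = "class_F e r L M D \<gamma> \<delta> R"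
  have "q \<le> \<epsilon> * real (steps I) ^ s"
    if I: "I \<in> valid_information e r Khat ?F"
      and err: "algorithm_error e a b ?F \<phi> I \<le> ereal \<epsilon>" for I \<phi> \<epsilon>
  proof -
    define n where "n = steps I"
    define N where "N = trunc I"
    define K where "K = Q * n"
    \<comment> \<open>The factor \<open>\<omega>\<close> maps the swept interval \<open>{0..X}\<close> onto \<open>K\<close> cells of length \<open>pi\<close>.\<close>
    define \<omega> where "\<omega> = real n * (real Q * pi / X)"
    define A where "A = D' / (B * (P * \<omega>) ^ s)"
    define f1 where "f1 = (\<lambda>_ :: 'a. m *\<^sub>R e 0)"
    have nN: "1 \<le> n" "1 \<le> N"
      using I by (auto simp: valid_information_def n_def N_def)
    have "\<omega> * X = real K * pi"
      using \<open>0 < X\<close> by (simp add: \<omega>_def K_def)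
    then have \<omega>X: "\<omega> * m * (b - a) = real K * pi"
      by (simp add: X_def mult.assoc)
    have "1 \<le> real Q * pi / X"
      using Q(2) \<open>0 < X\<close> by (simp add: field_simps)
    then have "1 * 1 \<le> \<omega>"
      unfolding \<omega>_def using nN by (intro mult_mono) auto
    then have "1 \<le> \<omega>" by simp
    have "1 * 1 \<le> P * \<omega>"
      using \<open>1 \<le> \<omega>\<close> P(1) by (intro mult_mono) auto
    then have P\<omega>: "1 \<le> P * \<omega>" by simp
    have "0 < A"
      using D' B P\<omega> by (simp add: A_def)
    have f1: "(f1, 0) \<in> ?F"
      unfolding f1_def
    proof (rule constant_in_class_F[OF e(1) _ P])
      show "norm (m *\<^sub>R e 0) \<le> M"
        using e(2) \<open>0 < m\<close> \<open>M > 0\<close> by (simp add: m_def)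
      show "norm (m *\<^sub>R e 0 - proj e k (m *\<^sub>R e 0)) \<le> \<delta> k"
        "norm (0 - proj e k 0) \<le> \<gamma> k" if "1 \<le> k" for k
        using that \<delta>_pos[OF that] \<gamma>_pos[OF that] linear_0[OF linear_proj[OF e(1)]]
        by (simp_all add: proj_basis[OF e(1)])
    qed (use e(2) assms in auto)
    define pts where "pts = (\<lambda>i. fst (asked e I f1 0 i)) ` {..<total_evals I}"
    define Y where "Y = (\<lambda>y. \<omega> * coord e (proj e N y) 0) ` pts"
    define S where "S = {k. k < K \<and> (\<forall>x\<in>Y. x \<notin> {real k * pi..real (Suc k) * pi})}"
    define g where "g = (\<lambda>l x. A * \<omega> ^ l * bumps p S l (\<omega> * x))"
    define f2 where "f2 = (\<lambda>y. m *\<^sub>R e 0 + g 0 (coord e y 0) *\<^sub>R e 1)"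
    have S: "S \<subseteq> {..<K}" "finite S"
      by (auto simp: S_def)
    have "finite pts" by (simp add: pts_def)
    have "real (card pts) \<le> Khat * real n"
      using I f1 by (auto simp: valid_information_def pts_def n_def)
    then have "4 * real (card Y) \<le> 4 * (Khat * real n)"
      using card_image_le[OF \<open>finite pts\<close>, of "\<lambda>y. \<omega> * coord e (proj e N y) 0"]
      unfolding Y_def by linarith
    also have "\<dots> \<le> real K"
      using mult_right_mono[OF Q(1), of "real n"] by (simp add: K_def)
    finally have "4 * real (card Y) \<le> real K" .
    moreover have "K - 2 * card Y \<le> card S"
      unfolding S_def by (rule free_cells) (simp add: Y_def \<open>finite pts\<close>)
    ultimately have card_S: "real K / 2 \<le> real (card S)"
      by linarith
    have g_bound: "\<bar>g l x\<bar> * P ^ l \<le> D'" if "l \<le> s" for l x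
    proof -
      have "\<bar>g l x\<bar> * P ^ l = A * (P * \<omega>) ^ l * \<bar>bumps p S l (\<omega> * x)\<bar>"
        using \<open>0 < A\<close> \<open>1 \<le> \<omega>\<close> by (simp add: g_def abs_mult power_mult_distrib)
      also have "\<dots> \<le> A * (P * \<omega>) ^ s * B"
        using \<open>0 < A\<close> P\<omega> B that by (intro mult_mono power_increasing bumps_bound) auto
      also have "\<dots> = D'"
      proof -
        have "B * (P * \<omega>) ^ s \<noteq> 0"
          using B(1) P\<omega> by auto
        moreover have "A * (P * \<omega>) ^ s * B = D' / (B * (P * \<omega>) ^ s) * (B * (P * \<omega>) ^ s)"
          unfolding A_def by (simp only: mult_ac)
        ultimately show ?thesis
          by (metis nonzero_eq_divide_eq)
      qed
      finally show ?thesis .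
    qed
    have f2: "(f2, 0) \<in> ?F"
      unfolding f2_def
    proof (rule ridge_in_class_F[OF linear_coord[OF e(1)] P e(2)])
      fix l x assume "l \<le> max r 1"
      then have "(bumps p S l has_real_derivative bumps p S (Suc l) (\<omega> * x)) (at (\<omega> * x))"
        by (intro bumps_has_derivative S) (simp add: p_def s_def)
      moreover have "((\<lambda>x. \<omega> * x) has_real_derivative \<omega>) (at x)"
        by (auto intro!: derivative_eq_intros)
      ultimately have "((\<lambda>x. bumps p S l (\<omega> * x)) has_real_derivative
          bumps p S (Suc l) (\<omega> * x) * \<omega>) (at x)"
        by (rule DERIV_chain2)
      from DERIV_cmult[OF this, of "A * \<omega> ^ l"]
      show "(g l has_real_derivative g (Suc l) x) (at x)"
        by (simp add: g_def mult_ac)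
    next
      show "\<bar>g 1 x\<bar> * P \<le> L" for x
        using g_bound[of 1 x] D'(3) by (simp add: s_def)
      show "\<bar>g l x\<bar> * P ^ l \<le> D" if "1 \<le> l" "l \<le> r" for l x
        using g_bound[of l x] D'(2) that by (simp add: s_def)
      show "norm (0 - proj e k 0) \<le> \<gamma> k" if "1 \<le> k" for k
        using \<gamma>_pos[OF that] linear_0[OF linear_proj[OF e(1)]] by simp
      have g0: "\<bar>g 0 x\<bar> \<le> D'" for x
        using g_bound[of 0 x] by simp
      have "norm (m *\<^sub>R e 0 + g 0 x *\<^sub>R e 1) \<le> m + \<bar>g 0 x\<bar>" for x
        using norm_triangle_ineq[of "m *\<^sub>R e 0" "g 0 x *\<^sub>R e 1"] e(2) \<open>0 < m\<close> by simp
      then show "norm (m *\<^sub>R e 0 + g 0 (coord e 0 0) *\<^sub>R e 1) \<le> M"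
        using g0[of "coord e 0 0"] D'(4) unfolding m_def
        by (smt (verit) field_sum_of_halves)
      show "norm (m *\<^sub>R e 0 + g 0 (coord e y 0) *\<^sub>R e 1 -
          proj e k (m *\<^sub>R e 0 + g 0 (coord e y 0) *\<^sub>R e 1)) \<le> \<delta> k" if "1 \<le> k" for k y
      proof (cases "k = 1")
        case True
        then show ?thesis
          using g0[of "coord e y 0"] D'(5) e(2)
          by (simp add: linear_add[OF linear_proj[OF e(1)]] proj_basis[OF e(1)])
      next
        case False
        then show ?thesis
          using that \<delta>_pos[OF that]
          by (simp add: linear_add[OF linear_proj[OF e(1)]] proj_basis[OF e(1)])
      qed
    qed
    have same: "information_value e I f1 0 = information_value e I f2 0"
    proof (rule information_value_cong)
      fix i assume i: "i < total_evals I"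
      obtain y j "is" where q: "asked e I f1 0 i = (y, j, is)"
        by (metis surj_pair)
      have "y \<in> pts"
        using i q unfolding pts_def by force
      define U where "U = (\<lambda>x. \<omega> * x) -` (- cells S)"
      have "open U"
        unfolding U_def using closed_cells[OF S(2)]
        by (intro open_vimage continuous_intros) auto
      moreover have "coord e (proj e N y) 0 \<in> U"
        using \<open>y \<in> pts\<close> by (auto simp: U_def cells_def S_def Y_def)
      moreover have "coord e (f1 x) j = coord e (f2 x) j" if "coord e x 0 \<in> U" for x
        using that by (simp add: f1_def f2_def g_def U_def bumps_def)
      ultimately have "partial_derivative e is (\<lambda>x. coord e (f1 x) j) (proj e N y) =
          partial_derivative e is (\<lambda>x. coord e (f2 x) j) (proj e N y)"
        by (intro partial_derivative_cong_open[OF linear_coord[OF e(1), of 0], of U])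
      then show "answer e (trunc I) f1 (asked e I f1 0 i) = answer e (trunc I) f2 (asked e I f1 0 i)"
        by (simp add: answer_def q N_def)
    qed simp
    define \<Psi> where "\<Psi> u = integral {0..u} (bumps p S 0)" for u
    define z1 where "z1 = (\<lambda>t. ((t - a) * m) *\<^sub>R e 0)"
    define z2 where "z2 = (\<lambda>t. ((t - a) * m) *\<^sub>R e 0 +
      (A / (\<omega> * m) * \<Psi> (\<omega> * m * (t - a))) *\<^sub>R e 1)"
    have z1: "solves_ivp f1 a b 0 z1"
      using solves_ivp_affine[of "m *\<^sub>R e 0" a b 0] by (simp add: f1_def z1_def)
    have cont: "continuous_on T (bumps p S 0)" for T
      using bumps_has_derivative[OF S(2), of 0 p]
      by (intro DERIV_continuous_on) (auto simp: p_def intro: has_field_derivative_at_within)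
    have "solves_ivp (\<lambda>y. m *\<^sub>R e 0 + (A * bumps p S 0 (\<omega> * coord e y 0)) *\<^sub>R e 1) a b 0 z2"
      unfolding z2_def
    proof (rule solves_ivp_ridge[OF e(1) \<open>0 < m\<close>])
      show "(\<Psi> has_real_derivative bumps p S 0 u) (at u within {0..\<omega> * m * (b - a)})"
        if "u \<in> {0..\<omega> * m * (b - a)}" for u
        unfolding \<Psi>_def[abs_def] by (rule integral_has_real_derivative[OF cont that])
    qed (use \<open>1 \<le> \<omega>\<close> in \<open>auto simp: \<Psi>_def\<close>)
    then have z2: "solves_ivp f2 a b 0 z2"
      by (simp add: f2_def g_def)
    have "\<Psi> (real K * pi) = real (card S) * W"
      unfolding \<Psi>_def W_def by (intro integral_bumps S) (auto simp: p_def)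
    have "q / real n ^ s = A / (\<omega> * m) * (real K / 2 * W) / 2"
    proof -
      have "A = D' / (B * (\<kappa> ^ s * real n ^ s))"
        by (simp add: A_def \<omega>_def \<kappa>_def power_mult_distrib power_divide mult_ac)
      then have "q / real n ^ s = A * ((b - a) / pi) * W / 4"
        by (simp add: q_def mult_ac)
      moreover have "real K / (\<omega> * m) = (b - a) / pi"
        using \<omega>X \<open>0 < m\<close> \<open>1 \<le> \<omega>\<close> by (simp add: field_simps)
      moreover have "A / (\<omega> * m) * (real K / 2 * W) / 2 = A * (real K / (\<omega> * m)) * W / 4"
        by simp
      ultimately show ?thesis
        by (simp only:)
    qed
    also have "\<dots> \<le> A / (\<omega> * m) * (real (card S) * W) / 2"
      using card_S \<open>0 < A\<close> \<open>1 \<le> \<omega>\<close> \<open>0 < m\<close> \<open>0 < W\<close>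
      by (intro divide_right_mono mult_left_mono mult_right_mono) auto
    also have "\<dots> \<le> norm (z1 b - z2 b) / 2"
    proof -
      define x where "x = A / (\<omega> * m) * (real (card S) * W)"
      have "norm (z1 b - z2 b) = \<bar>x\<bar>"
        unfolding z1_def z2_def \<omega>X \<open>\<Psi> (real K * pi) = real (card S) * W\<close> x_def[symmetric]
        using e(2) by simp
      then show ?thesis
        unfolding x_def[symmetric] by simp
    qed
    also have "\<dots> \<le> \<epsilon>"
      using indistinguishable_solutions_close[OF err f1 f2 z1 z2 same, of b] ab by simp
    finally show ?thesis
      using nN by (simp add: n_def field_simps)
  qed
  moreover have "0 < q"
    using D' \<open>0 < W\<close> ab B(1) \<open>0 < \<kappa>\<close> by (simp add: q_def)
  ultimately show thesis using that unfolding s_def by blast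
qed

section \<open>Lower bound for the cost\<close>

lemma info_cost_ge:
  assumes "0 \<le> c (trunc I)"
    and "real (card {k. k < steps I \<and> real (evals I k) \<ge> \<kappa>2 * real (trunc I)}) \<ge> \<kappa>1 * real (steps I)"
    and "0 < \<kappa>2"
  shows "info_cost c I \<ge> \<kappa>1 * \<kappa>2 * real (steps I) * c (trunc I) * real (trunc I)"
proof -
  define G where "G = {k. k < steps I \<and> real (evals I k) \<ge> \<kappa>2 * real (trunc I)}"
  have "\<kappa>1 * \<kappa>2 * real (steps I) * c (trunc I) * real (trunc I) =
      \<kappa>1 * real (steps I) * (c (trunc I) * (\<kappa>2 * real (trunc I)))"
    by simp
  also have "\<dots> \<le> real (card G) * (c (trunc I) * (\<kappa>2 * real (trunc I)))"
    using assms unfolding G_def by (intro mult_right_mono) auto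
  also have "\<dots> = (\<Sum>k\<in>G. c (trunc I) * (\<kappa>2 * real (trunc I)))"
    by simp
  also have "\<dots> \<le> (\<Sum>k\<in>G. c (trunc I) * real (evals I k))"
    using assms(1) by (intro sum_mono mult_left_mono) (auto simp: G_def)
  also have "\<dots> \<le> info_cost c I"
    unfolding info_cost_def using assms(1) by (intro sum_mono2) (auto simp: G_def)
  finally show ?thesis .
qed

lemma n_of_le_steps:
  assumes "0 < q" and "0 < \<epsilon>" and "q \<le> \<epsilon> * real n ^ max r 1"
  shows "q powr (1 / real (max r 1)) * n_of r \<epsilon> \<le> real n"
proof -
  let ?s = "max r 1"
  have "n \<noteq> 0"
    using assms by (cases "n = 0") (auto simp: power_0_left split: if_splits)
  have "q powr (1 / real ?s) * n_of r \<epsilon> = (q / \<epsilon>) powr (1 / real ?s)"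
    using assms by (simp add: n_of_def powr_divide)
  also have "\<dots> \<le> (real n ^ ?s) powr (1 / real ?s)"
    using assms by (intro powr_mono2) (auto simp: field_simps)
  also have "\<dots> = real n"
    using \<open>n \<noteq> 0\<close> by (simp add: powr_powr flip: powr_realpow)
  finally show ?thesis .
qed

lemma seq_inverse_le:
  assumes "1 \<le> N" and "g N \<le> x"
  shows "seq_inverse g x \<le> N"
  unfolding seq_inverse_def using assms by (intro Least_le) simp

text \<open>
  The minimum in \<open>seq_inverse\<close> is attained because the sequence converges to \<open>0\<close>.
\<close>

lemma one_le_seq_inverse:
  assumes "positive_nonincreasing_null g" and "0 < x"
  shows "1 \<le> seq_inverse g x"
proof -
  have "g \<longlonglongrightarrow> 0"
    using assms(1) by (simp add: positive_nonincreasing_null_def nonincreasing_null_def)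
  then have "eventually (\<lambda>k. g k < x) sequentially"
    using assms(2) by (rule order_tendstoD)
  then obtain k where "1 \<le> k" "g k \<le> x"
    by (metis eventually_sequentially le_add1 le_add2 less_imp_le)
  then show ?thesis
    unfolding seq_inverse_def by (metis (mono_tags, lifting) LeastI)
qed

theorem proposition2:
  fixes e :: "nat \<Rightarrow> 'a::banach"
    and a b L M D R Khat Khat1 :: real
    and \<gamma> \<delta> \<alpha> c :: "nat \<Rightarrow> real"
    and t :: "nat \<Rightarrow> nat \<Rightarrow> real"
    and r :: nat
    and \<I> :: "'a information set"
  assumes "schauder_basis e"
    and "\<And>j. norm (e j) = 1"
    and "basis_constant e < \<infinity>"
    and "a < b"
    and "L > 0" and "M > 0" and "D > 0"
    and "positive_nonincreasing_null \<gamma>"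
    and "positive_nonincreasing_null \<delta>"
    and "admissible_radius e r L M \<gamma> a b R"
    and "nonincreasing_null \<alpha>"
    and "\<And>n. 1 \<le> n \<Longrightarrow> \<alpha> n \<le> Khat1 / real n"
    and "\<And>n. 1 \<le> n \<Longrightarrow> is_partition a b n (t n) \<and> mesh_le n (t n) (\<alpha> n)"
    and "\<And>N. 1 \<le> N \<Longrightarrow> 0 \<le> c N"
    and "mono_on {1..} c"
    and "\<I> \<subseteq> valid_information e r Khat (class_F e r L M D \<gamma> \<delta> R)"
    and "condition_C \<I>"
  shows "\<exists>C2>0. \<exists>\<epsilon>0>0. \<forall>\<epsilon>. 0 < \<epsilon> \<and> \<epsilon> < \<epsilon>0 \<longrightarrow>
    complexity e a b (class_F e r L M D \<gamma> \<delta> R) c \<I> \<epsilon> \<ge>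
      ereal (C2 * n_of r \<epsilon> * c (N_of \<gamma> \<delta> (\<epsilon> / C2)) * real (N_of \<gamma> \<delta> (\<epsilon> / C2)))"
proof -
  let ?F = "class_F e r L M D \<gamma> \<delta> R"
  note basics = assms(1-9)
  obtain q where "0 < q" and q: "\<And>I \<phi> \<epsilon>. I \<in> valid_information e r Khat ?F \<Longrightarrow>
      algorithm_error e a b ?F \<phi> I \<le> ereal \<epsilon> \<Longrightarrow> q \<le> \<epsilon> * real (steps I) ^ max r 1"
    using error_times_steps_power_bounded_below[OF basics, of r Khat R] by blast
  obtain \<kappa>1 \<kappa>2 where "0 < \<kappa>1" "0 < \<kappa>2" and \<kappa>: "\<And>I. I \<in> \<I> \<Longrightarrow>
      real (card {k. k < steps I \<and> real (evals I k) \<ge> \<kappa>2 * real (trunc I)}) \<ge> \<kappa>1 * real (steps I)"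
    using assms(17) unfolding condition_C_def by blast
  define q' where "q' = q powr (1 / real (max r 1))"
  \<comment> \<open>The first term collects the constants of the cost estimate; the other two turn the bounds
    \<open>2 * \<epsilon>\<close> on \<open>\<gamma> N\<close> and \<open>2 * \<epsilon> / (b - a)\<close> on \<open>\<delta> N\<close> into \<open>\<epsilon> / C2\<close>.\<close>
  define C2 where "C2 = min (\<kappa>1 * \<kappa>2 * q') (min (1 / 2) ((b - a) / 2))"
  define \<epsilon>0 where "\<epsilon>0 = M * (b - a) / 2"
  have "0 < q'" using \<open>0 < q\<close> by (simp add: q'_def)
  then have C2: "0 < C2" "C2 \<le> \<kappa>1 * \<kappa>2 * q'" "C2 \<le> 1 / 2" "C2 \<le> (b - a) / 2"
    using \<open>0 < \<kappa>1\<close> \<open>0 < \<kappa>2\<close> assms(4) unfolding C2_def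
    by (simp_all only: min.cobounded1 min.coboundedI2 min.cobounded2 min_less_iff_conj) simp
  have "0 < \<epsilon>0" using assms(4,6) by (simp add: \<epsilon>0_def)
  have bound: "C2 * n_of r \<epsilon> * c (N_of \<gamma> \<delta> (\<epsilon> / C2)) * real (N_of \<gamma> \<delta> (\<epsilon> / C2)) \<le> info_cost c I"
    if \<epsilon>: "0 < \<epsilon>" "\<epsilon> < \<epsilon>0" and "I \<in> \<I>" and err: "algorithm_error e a b ?F \<phi> I \<le> ereal \<epsilon>"
    for \<epsilon> I \<phi>
  proof -
    define n where "n = steps I"
    define N where "N = trunc I"
    define N' where "N' = N_of \<gamma> \<delta> (\<epsilon> / C2)"
    have I: "I \<in> valid_information e r Khat ?F"
      using assms(16) \<open>I \<in> \<I>\<close> by blast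
    then have N: "1 \<le> trunc I" "1 \<le> N"
      by (auto simp: valid_information_def N_def)
    have "2 * \<epsilon> \<le> \<epsilon> / C2"
      using mult_left_mono[OF C2(3), of "\<epsilon>"] \<epsilon> C2(1) by (simp add: field_simps)
    then have \<gamma>N: "\<gamma> N \<le> \<epsilon> / C2"
      using initial_tail_le_error[OF basics N(1) err] by (simp add: N_def)
    \<comment> \<open>For \<open>\<epsilon> < \<epsilon>0\<close> the minimum in \<open>rhs_tail_le_error\<close> cannot be \<open>M\<close>.\<close>
    have "M * (b - a) > 2 * \<epsilon>"
      using \<epsilon>(2) by (simp add: \<epsilon>0_def)
    then have "\<delta> N * (b - a) \<le> 2 * \<epsilon>"
      using rhs_tail_le_error[OF basics I err] by (auto simp: N_def min_def split: if_splits)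
    then have "\<delta> N \<le> \<epsilon> / ((b - a) / 2)"
      using assms(4) by (simp add: field_simps)
    also have "\<dots> \<le> \<epsilon> / C2"
      using C2 \<epsilon> by (intro divide_left_mono) auto
    finally have "N' \<le> N"
      using \<gamma>N N(2) seq_inverse_le unfolding N'_def N_of_def by (simp add: seq_inverse_le)
    have "1 \<le> N'"
      unfolding N'_def N_of_def using one_le_seq_inverse[OF assms(8), of "\<epsilon> / C2"] \<epsilon>(1) C2(1)
      by (simp add: le_max_iff_disj)
    have c: "0 \<le> c N'" "c N' \<le> c N"
      using \<open>1 \<le> N'\<close> \<open>N' \<le> N\<close> assms(14) mono_onD[OF assms(15), of N' N] by auto
    have n: "q' * n_of r \<epsilon> \<le> real n"
      unfolding q'_def n_def using n_of_le_steps[OF \<open>0 < q\<close> \<epsilon>(1) q[OF I err]] .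
    have "0 \<le> n_of r \<epsilon>" by (simp add: n_of_def)
    then have "C2 * n_of r \<epsilon> \<le> \<kappa>1 * \<kappa>2 * q' * n_of r \<epsilon>"
      by (intro mult_right_mono C2)
    also have "\<dots> = \<kappa>1 * \<kappa>2 * (q' * n_of r \<epsilon>)"
      by simp
    also have "\<dots> \<le> \<kappa>1 * \<kappa>2 * real n"
      using n \<open>0 < \<kappa>1\<close> \<open>0 < \<kappa>2\<close> by (intro mult_left_mono) auto
    finally have "C2 * n_of r \<epsilon> * c N' * real N' \<le> \<kappa>1 * \<kappa>2 * real n * c N * real N"
      using c \<open>N' \<le> N\<close> \<open>0 < \<kappa>1\<close> \<open>0 < \<kappa>2\<close>
      by (intro mult_mono[where a = "C2 * n_of r \<epsilon> * c N'"]
          mult_mono[where a = "C2 * n_of r \<epsilon>"]) auto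
    also have "\<dots> \<le> info_cost c I"
      unfolding n_def N_def
      using info_cost_ge[OF _ \<kappa>[OF \<open>I \<in> \<I>\<close>] \<open>0 < \<kappa>2\<close>] assms(14) N(1) by simp
    finally show ?thesis unfolding N'_def .
  qed
  show ?thesis
  proof (rule exI[of _ C2], rule conjI[OF C2(1)], rule exI[of _ \<epsilon>0],
      rule conjI[OF \<open>0 < \<epsilon>0\<close>], intro allI impI)
    fix \<epsilon> assume "0 < \<epsilon> \<and> \<epsilon> < \<epsilon>0"
    then show "complexity e a b ?F c \<I> \<epsilon> \<ge>
        ereal (C2 * n_of r \<epsilon> * c (N_of \<gamma> \<delta> (\<epsilon> / C2)) * real (N_of \<gamma> \<delta> (\<epsilon> / C2)))"
      unfolding complexity_def using bound by (intro INF_greatest) auto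
  qed
qed

end
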